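(* Let $h>0$, $u,u'>0$ and $z,z'\in\mathbb C$, and put $\mathbf x=(u,z)$, $\mathbf x'=(u',z')$. Assume that $$\mathrm{Re}(z)\neq\mathrm{Re}(z')\quad\text{or}\quad u>u'-|\mathrm{Im}(z-z')| .$$ Then the AdS$_2$ bulk-to-bulk scalar propagator $G_h$ has the integral representation $$G_h(\mathbf x,\mathbf x')=\int_{z'-iu'}^{z'+iu'}dw\;\widehat G_h(\mathbf x,\mathbf x',w),$$ where $$G_h(\mathbf x,\mathbf x')=\Big(\frac{uu'}{u^2+u'^2+(z-z')^2}\Big)^h{}_2F_1\Big(\frac h2,\frac h2+\frac12;h+\frac12;\Big(\frac{2uu'}{u^2+u'^2+(z-z')^2}\Big)^2\Big),$$ $$\widehat G_h(\mathbf x,\mathbf x',w)=\frac{-2i}{4^h}\frac{\Gamma(2h)}{\Gamma(h)\Gamma(h)}\Big(\frac{u'}{u'^2+(z'-w)^2}\Big)^{1-h}\Big(\frac{u}{u^2+(z-w)^2}\Big)^{h}.$$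
   Context: The integral is a complex line integral over the straight segment from $z'-iu'$ to $z'+iu'$; $w\in\mathbb C$. ${}_2F_1$ is the Gauss hypergeometric function.
   Formalization: Added assumption: u²+u'²+(z−z')² ≠ 0 and the argument of 2F1 is not in [1,∞). It is automatic if Re z ≠ Re z'; if Re z = Re z' it excludes |u−u'| ≤ |Im(z−z')| ≤ u+u', where the integrand is singular on the segment and 2F1 is on its cut (e.g. h=u=u'=1, z−z'=i diverges). *)

theory Defs
  imports "HOL-Complex_Analysis.Complex_Analysis"
begin

text \<open>
  The Gauss hypergeometric function \<open>2F1(a, b; c; z)\<close> is the holomorphic continuation of the
  hypergeometric series to the plane cut along \<open>[1, \<infinity>)\<close>.  It has no value on the cut, where the
  description operator below leaves it arbitrary; off the cut the continuation is unique, see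
  \<open>hyp2F1_eqI\<close>.  As usual, \<open>c\<close> is meant not to be a non-positive integer.
\<close>

definition hyp2F1_domain :: "complex set" where
  "hyp2F1_domain = - complex_of_real ` {1..}"

definition hyp2F1 :: "complex \<Rightarrow> complex \<Rightarrow> complex \<Rightarrow> complex \<Rightarrow> complex" where
  "hyp2F1 a b c = (SOME F. F holomorphic_on hyp2F1_domain \<and>
     F has_fps_expansion fps_hypergeo [a, b] [c] 1)"

lemma open_hyp2F1_domain: "open hyp2F1_domain"
proof -
  have "complex_of_real ` {1..} = {z. 1 \<le> Re z} \<inter> {z. Im z = 0}"
    by (auto simp: complex_eq_iff image_iff)
  then show ?thesis
    unfolding hyp2F1_domain_def
    by (auto intro!: open_Compl closed_Int closed_halfspace_Re_ge closed_Collect_eq continuous_intros)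
qed

lemma connected_hyp2F1_domain: "connected hyp2F1_domain"
proof -
  have "starlike hyp2F1_domain"
    unfolding starlike_def
  proof (intro bexI[of _ 0] ballI subsetI)
    fix z x :: complex
    assume z: "z \<in> hyp2F1_domain" and "x \<in> closed_segment 0 z"
    then obtain t where t: "0 \<le> t" "t \<le> 1" "x = of_real t * z"
      by (auto simp: in_segment scaleR_conv_of_real)
    show "x \<in> hyp2F1_domain"
    proof (rule ccontr)
      assume "x \<notin> hyp2F1_domain"
      then obtain r where r: "r \<ge> 1" "of_real t * z = complex_of_real r"
        by (auto simp: hyp2F1_domain_def t)
      then have "t > 0" using t by (cases "t = 0") auto
      then have "z = complex_of_real (r / t)" "r / t \<ge> 1"
        using r t by (auto simp: field_simps)
      then show False using z unfolding hyp2F1_domain_def by blast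
    qed
  qed (auto simp: hyp2F1_domain_def complex_eq_iff image_iff)
  then show ?thesis by (rule starlike_imp_connected)
qed

lemma hyp2F1_eqI:
  assumes "F holomorphic_on hyp2F1_domain"
    and "F has_fps_expansion fps_hypergeo [a, b] [c] 1"
    and "z \<in> hyp2F1_domain"
  shows "hyp2F1 a b c z = F z"
proof -
  have H: "hyp2F1 a b c holomorphic_on hyp2F1_domain"
    "hyp2F1 a b c has_fps_expansion fps_hypergeo [a, b] [c] 1"
    using someI[of "\<lambda>F. F holomorphic_on hyp2F1_domain \<and>
      F has_fps_expansion fps_hypergeo [a, b] [c] 1" F] assms(1,2)
    unfolding hyp2F1_def by auto
  have "(\<lambda>w. hyp2F1 a b c w - F w) has_fps_expansion 0"
    using has_fps_expansion_diff[OF H(2) assms(2)] by simp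
  moreover have "(\<lambda>w. hyp2F1 a b c w - F w) holomorphic_on hyp2F1_domain"
    by (intro holomorphic_intros H assms)
  ultimately have "hyp2F1 a b c z - F z = 0"
    by (rule has_fps_expansion_0_analytic_continuation)
      (use assms(3) open_hyp2F1_domain connected_hyp2F1_domain in
        \<open>auto simp: hyp2F1_domain_def complex_eq_iff image_iff\<close>)
  then show ?thesis by simp
qed

text \<open>
  A point \<open>\<^bold>x = (u, z)\<close> of (complexified) \<open>AdS\<^sub>2\<close> is a pair of a radial coordinate \<open>u\<close> and a boundary
  coordinate \<open>z\<close>.  All complex powers are principal.
\<close>

fun bulk_denom :: "real \<times> complex \<Rightarrow> real \<times> complex \<Rightarrow> complex" where
  "bulk_denom (u, z) (u', z') = of_real u ^ 2 + of_real u' ^ 2 + (z - z') ^ 2"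

fun bulk_hyp_arg :: "real \<times> complex \<Rightarrow> real \<times> complex \<Rightarrow> complex" where
  "bulk_hyp_arg (u, z) (u', z') = (2 * of_real u * of_real u' / bulk_denom (u, z) (u', z')) ^ 2"

fun bulk_propagator :: "real \<Rightarrow> real \<times> complex \<Rightarrow> real \<times> complex \<Rightarrow> complex" where
  "bulk_propagator h (u, z) (u', z') =
     (of_real u * of_real u' / bulk_denom (u, z) (u', z')) powr of_real h *
     hyp2F1 (of_real h / 2) (of_real h / 2 + 1 / 2) (of_real h + 1 / 2)
       (bulk_hyp_arg (u, z) (u', z'))"

fun propagator_kernel ::
    "real \<Rightarrow> real \<times> complex \<Rightarrow> real \<times> complex \<Rightarrow> complex \<Rightarrow> complex" where
  "propagator_kernel h (u, z) (u', z') w =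
     - 2 * \<i> / 4 powr of_real h * (Gamma (2 * of_real h) / (Gamma (of_real h) * Gamma (of_real h))) *
     (of_real u' / (of_real u' ^ 2 + (z' - w) ^ 2)) powr (1 - of_real h) *
     (of_real u / (of_real u ^ 2 + (z - w) ^ 2)) powr of_real h"

text \<open>
  The propagator is defined at a pair of points if no denominator vanishes and the argument of
  \<open>2F1\<close> avoids the branch cut.  This can fail only for \<open>Re z = Re z'\<close>, namely when
  \<open>\<bar>u - u'\<bar> \<le> \<bar>Im (z - z')\<bar> \<le> u + u'\<close>; the integrand then has a pole or branch point on the
  segment of integration.
\<close>

definition bulk_propagator_defined :: "real \<times> complex \<Rightarrow> real \<times> complex \<Rightarrow> bool" where
  "bulk_propagator_defined x x' \<longleftrightarrow> bulk_denom x x' \<noteq> 0 \<and> bulk_hyp_arg x x' \<in> hyp2F1_domain"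

lemma bulk_propagator_defined_if_Re_neq:
  assumes "u > 0" "u' > 0" "Re z \<noteq> Re z'"
  shows "bulk_propagator_defined (u, z) (u', z')"
proof -
  define p q where "p = Re (z - z')" and "q = Im (z - z')"
  have p: "p \<noteq> 0" using assms by (simp add: p_def)
  define D where "D = bulk_denom (u, z) (u', z')"
  have zz: "z - z' = Complex p q" by (simp add: p_def q_def complex_eq_iff)
  have D: "Re D = u\<^sup>2 + u'\<^sup>2 + p\<^sup>2 - q\<^sup>2" "Im D = 2 * p * q"
    unfolding D_def bulk_denom.simps zz by (simp_all add: power2_eq_square)
  have pos: "p\<^sup>2 > 0" using p by simp
  have no: "\<not> (Im D = 0 \<and> Re D \<le> 2 * u * u')"
  proof
    assume "Im D = 0 \<and> Re D \<le> 2 * u * u'"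
    then have "q = 0" "u\<^sup>2 + u'\<^sup>2 + p\<^sup>2 \<le> 2 * u * u'" using D p by auto
    moreover have "(u - u')\<^sup>2 \<ge> 0" by simp
    ultimately show False using pos by (simp add: power2_diff)
  qed
  have "D \<noteq> 0" using no assms by auto
  moreover have "(2 * of_real u * of_real u' / D)\<^sup>2 \<in> hyp2F1_domain"
  proof (rule ccontr)
    assume "(2 * of_real u * of_real u' / D)\<^sup>2 \<notin> hyp2F1_domain"
    then obtain r where r: "r \<ge> 1" "(2 * of_real u * of_real u' / D)\<^sup>2 = complex_of_real r"
      by (auto simp: hyp2F1_domain_def)
    have "(2 * of_real u * of_real u' / D)\<^sup>2 = (complex_of_real (sqrt r))\<^sup>2"
      using r by (simp flip: of_real_power)
    then obtain s where s: "s = sqrt r \<or> s = - sqrt r"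
      "2 * of_real u * of_real u' / D = complex_of_real s"
      by (auto simp: power2_eq_iff)
    have "s \<noteq> 0" using s r by auto
    then have "D = complex_of_real (2 * u * u' / s)"
      using s(2) \<open>D \<noteq> 0\<close> by (auto simp: field_simps)
    then have "Im D = 0" "Re D = 2 * u * u' / s" by simp_all
    moreover have "2 * u * u' / s \<le> 2 * u * u'"
    proof (cases "s > 0")
      case True
      then have "s \<ge> 1" using s r by auto
      moreover have "2 * u * u' * 1 \<le> 2 * u * u' * s"
        using \<open>s \<ge> 1\<close> assms by (intro mult_left_mono) auto
      ultimately show ?thesis by (simp add: divide_le_eq)
    next
      case False
      then have "2 * u * u' / s \<le> 0" using assms by (simp add: divide_nonneg_nonpos)
      then show ?thesis using assms by (smt (verit) mult_pos_pos)
    qed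
    ultimately show False using no by simp
  qed
  ultimately show ?thesis by (simp add: bulk_propagator_defined_def D_def)
qed

end

theory Submission
  imports Defs
begin

text \<open>
  Put \<open>\<zeta> = z - z'\<close>, \<open>k = u' / (u + \<i> \<zeta>)\<close>, \<open>l = u' / (u - \<i> \<zeta>)\<close> and parametrise the contour by
  \<open>w = z' + \<i> u' t\<close>.  Then \<open>u\<^sup>2 + (z - w)\<^sup>2\<close> is proportional to \<open>(1 + k t) (1 - l t)\<close>, so that up to
  elementary factors the contour integral is
  \<open>I(k, l) = \<integral> (1 - t\<^sup>2)\<^sup>h\<^sup>-\<^sup>1 (1 + k t)\<^sup>-\<^sup>h (1 - l t)\<^sup>-\<^sup>h dt\<close>, taken over \<open>[-1, 1]\<close>.
  The four exponents add up to \<open>-2\<close>, hence there is no singularity at infinity, and the Moebius map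
  \<open>x = (t + k) / (1 + k t)\<close>, which fixes \<open>\<plusminus>1\<close>, removes one of the two moving branch points:
  \<open>I(k, l) = (1 + k l)\<^sup>-\<^sup>h I(0, \<eta>)\<close> with \<open>\<eta> = (k + l) / (1 + k l) = 2 u u' / (u\<^sup>2 + u'\<^sup>2 + \<zeta>\<^sup>2)\<close>.
  This is a substitution for real \<open>k\<close> and \<open>l\<close>, which covers \<open>Re z = Re z'\<close>; for the other
  configurations it is continued analytically, first to small complex \<open>k\<close> and \<open>l\<close> and then along the rays
  \<open>(r k, r l)\<close>, which amounts to growing \<open>u'\<close> from \<open>0\<close>.  Finally, the moments of \<open>(1 - t\<^sup>2)\<^sup>h\<^sup>-\<^sup>1\<close> turn
  the binomial series of \<open>I(0, \<eta>)\<close> into the hypergeometric series in \<open>\<eta>\<^sup>2\<close>, only even powers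
  of \<open>t\<close> contributing.
\<close>

section \<open>Parameter integrals against a weight singular at the endpoints\<close>

text \<open>The weight may be unbounded at \<open>a\<close> and \<open>b\<close>, so the Leibniz
  rule is used only on compact subintervals of the open interval. The truncated integrals are
  holomorphic and converge locally uniformly, since the error is at most a bound of \<open>g\<close>
  times the weight of the two ends cut off.\<close>

lemma holomorphic_on_weighted_integral:
  fixes g :: "complex \<Rightarrow> real \<Rightarrow> complex" and \<omega> :: "real \<Rightarrow> real"
  assumes "open S" and ab: "a < b"
    and \<omega>: "\<omega> integrable_on {a..b}" "continuous_on {a<..<b} \<omega>" "\<And>t. t \<in> {a..b} \<Longrightarrow> \<omega> t \<ge> 0"
    and g: "continuous_on (S \<times> {a..b}) (\<lambda>(z, t). g z t)"
    and g': "\<And>z t. z \<in> S \<Longrightarrow> t \<in> {a..b} \<Longrightarrow> ((\<lambda>z. g z t) has_field_derivative g' z t) (at z)"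
      "continuous_on (S \<times> {a..b}) (\<lambda>(z, t). g' z t)"
    and int: "\<And>z. z \<in> S \<Longrightarrow> (\<lambda>t. of_real (\<omega> t) * g z t) integrable_on {a..b}"
  shows "(\<lambda>z. integral {a..b} (\<lambda>t. of_real (\<omega> t) * g z t)) holomorphic_on S"
proof -
  define G where "G = (\<lambda>z t. of_real (\<omega> t) * g z t)"
  \<comment> \<open>Weights of subintervals are differences of \<open>W\<close>; its continuity
    makes the weight of the removed ends tend to 0.\<close>
  define W where "W = (\<lambda>x. integral {a..x} \<omega>)"
  \<comment> \<open>The shift by 3 keeps \<open>\<delta> n\<close> below half the length, so that
    \<open>\<alpha> n < \<beta> n\<close> for every \<open>n\<close>, including 0.\<close>
  define \<delta> where "\<delta> = (\<lambda>n. (b - a) / real (n + 3))"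
  define \<alpha> where "\<alpha> = (\<lambda>n. a + \<delta> n)"
  define \<beta> where "\<beta> = (\<lambda>n. b - \<delta> n)"
  have small: "0 < \<delta> n" "\<delta> n < (b - a) / 2" for n
  proof -
    show "0 < \<delta> n" using ab by (simp add: \<delta>_def)
    show "\<delta> n < (b - a) / 2" unfolding \<delta>_def using ab by (intro divide_strict_left_mono) auto
  qed
  have order: "a < \<alpha> n" "\<alpha> n < \<beta> n" "\<beta> n < b" for n
    using small[of n] by (auto simp: \<alpha>_def \<beta>_def)
  have "\<delta> \<longlonglongrightarrow> 0"
    unfolding \<delta>_def by (rule LIMSEQ_ignore_initial_segment[OF lim_const_over_n])
  then have lims: "\<alpha> \<longlonglongrightarrow> a" "\<beta> \<longlonglongrightarrow> b"
    unfolding \<alpha>_def \<beta>_def by (auto intro!: tendsto_eq_intros)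
  have W: "continuous_on {a..b} W"
    unfolding W_def by (rule indefinite_integral_continuous_1[OF \<omega>(1)])
  have W_lims: "(\<lambda>n. W (\<alpha> n)) \<longlonglongrightarrow> W a" "(\<lambda>n. W (\<beta> n)) \<longlonglongrightarrow> W b"
    using order by (auto intro!: continuous_on_tendsto_compose[OF W lims(1)]
        continuous_on_tendsto_compose[OF W lims(2)] always_eventually less_imp_le[OF ab])
      (meson order less_imp_le less_trans)+
  have "W a = 0" by (simp add: W_def)
  \<comment> \<open>On a closed ball inside \<open>S\<close> compactness gives one bound
    \<open>M\<close> for \<open>g\<close>, valid for all \<open>t\<close>; this makes the
    convergence uniform.\<close>
  have local: "(\<lambda>z. integral {a..b} (G z)) holomorphic_on ball x e"
    if "cball x e \<subseteq> S" "e > 0" for x e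
  proof -
    have sub: "ball x e \<subseteq> S" using that(1) ball_subset_cball by blast
    have "compact ((\<lambda>(z, t). g z t) ` (cball x e \<times> {a..b}))"
      using that by (intro compact_continuous_image compact_Times continuous_on_subset[OF g]) auto
    then obtain M where "M > 0" and M': "\<And>y. y \<in> (\<lambda>(z, t). g z t) ` (cball x e \<times> {a..b}) \<Longrightarrow> norm y \<le> M"
      using compact_imp_bounded bounded_pos by metis
    have M: "norm (g z t) \<le> M" if "z \<in> ball x e" "t \<in> {a..b}" for z t
      using M'[of "g z t"] that by force
    have bound: "norm (integral {c..d} (G z)) \<le> M * (W d - W c)"
      if "z \<in> ball x e" "a \<le> c" "c \<le> d" "d \<le> b" for z c d
    proof -
      have I: "G z integrable_on {c..d}" "\<omega> integrable_on {c..d}"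
        unfolding G_def using that sub
        by (auto intro!: integrable_on_subinterval[OF int] integrable_on_subinterval[OF \<omega>(1)])
      have "norm (integral {c..d} (G z)) \<le> integral {c..d} (\<lambda>t. M * \<omega> t)"
      proof (rule integral_norm_bound_integral[OF I(1)])
        show "(\<lambda>t. M * \<omega> t) integrable_on {c..d}"
          using integrable_cmul[OF I(2), of M] by simp
        show "norm (G z t) \<le> M * \<omega> t" if "t \<in> {c..d}" for t
        proof -
          have "t \<in> {a..b}" using that \<open>a \<le> c\<close> \<open>d \<le> b\<close> by auto
          then show ?thesis
            using mult_right_mono[OF M[OF \<open>z \<in> ball x e\<close>] \<omega>(3)] \<omega>(3)[of t]
            by (simp add: G_def norm_mult mult.commute)
        qed
      qed
      also have "\<dots> = M * integral {c..d} \<omega>" by simp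
      also have "integral {c..d} \<omega> = W d - W c"
        unfolding W_def
        using Henstock_Kurzweil_Integration.integral_combine[of a c d \<omega>] that
          integrable_on_subinterval[OF \<omega>(1), of a d] by simp
      finally show ?thesis .
    qed
    have hol: "(\<lambda>z. integral (cbox (\<alpha> n) (\<beta> n)) (G z)) holomorphic_on ball x e" for n
    proof (rule leibniz_rule_holomorphic)
      have sub': "cbox (\<alpha> n) (\<beta> n) \<subseteq> {a..b}" "cbox (\<alpha> n) (\<beta> n) \<subseteq> {a<..<b}"
        using order[of n] by auto
      show "((\<lambda>z. G z t) has_field_derivative of_real (\<omega> t) * g' z t) (at z within ball x e)"
        if "z \<in> ball x e" "t \<in> cbox (\<alpha> n) (\<beta> n)" for z t
        unfolding G_def using that sub sub'
        by (intro DERIV_cmult has_field_derivative_at_within[OF g'(1)]) auto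
      show "G z integrable_on cbox (\<alpha> n) (\<beta> n)" if "z \<in> ball x e" for z
        using int that sub sub' unfolding G_def
        by (metis box_real(2) integrable_on_subinterval subsetD)
      have "continuous_on (ball x e \<times> cbox (\<alpha> n) (\<beta> n)) (\<lambda>p. \<omega> (snd p))"
        using sub' by (intro continuous_on_compose2[OF \<omega>(2)]) (auto intro!: continuous_intros)
      moreover have "continuous_on (ball x e \<times> cbox (\<alpha> n) (\<beta> n)) (\<lambda>(z, t). g' z t)"
        using sub sub' by (intro continuous_on_subset[OF g'(2)]) auto
      ultimately show "continuous_on (ball x e \<times> cbox (\<alpha> n) (\<beta> n)) (\<lambda>(z, t). of_real (\<omega> t) * g' z t)"
        by (auto simp: case_prod_unfold intro!: continuous_intros)
    qed auto
    have diff: "norm (integral {\<alpha> n..\<beta> n} (G z) - integral {a..b} (G z)) \<le>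
        M * (W (\<alpha> n) + (W b - W (\<beta> n)))" if "z \<in> ball x e" for z n
    proof -
      have I: "G z integrable_on {a..b}" using int that sub by (auto simp: G_def)
      have "integral {a..\<alpha> n} (G z) + integral {\<alpha> n..\<beta> n} (G z) + integral {\<beta> n..b} (G z) = integral {a..b} (G z)"
        using Henstock_Kurzweil_Integration.integral_combine[of a "\<alpha> n" "\<beta> n" "G z"]
          Henstock_Kurzweil_Integration.integral_combine[of a "\<beta> n" b "G z"] order[of n] I
          integrable_on_subinterval[OF I, of a "\<beta> n"] by simp
      then have "integral {\<alpha> n..\<beta> n} (G z) - integral {a..b} (G z) =
          - (integral {a..\<alpha> n} (G z) + integral {\<beta> n..b} (G z))"
        by (simp add: algebra_simps)
      then have "norm (integral {\<alpha> n..\<beta> n} (G z) - integral {a..b} (G z)) =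
          norm (integral {a..\<alpha> n} (G z) + integral {\<beta> n..b} (G z))"
        by (simp only: norm_minus_cancel)
      also have "\<dots> \<le> M * (W (\<alpha> n) - W a) + M * (W b - W (\<beta> n))"
        using order[of n] that by (intro norm_triangle_le add_mono bound) auto
      finally show ?thesis using \<open>W a = 0\<close> by (simp add: algebra_simps)
    qed
    have "(\<lambda>n. M * (W (\<alpha> n) + (W b - W (\<beta> n)))) \<longlonglongrightarrow> M * (W a + (W b - W b))"
      by (intro tendsto_intros W_lims)
    then have null: "(\<lambda>n. M * (W (\<alpha> n) + (W b - W (\<beta> n)))) \<longlonglongrightarrow> 0"
      using \<open>W a = 0\<close> by simp
    have unif: "uniform_limit (ball x e) (\<lambda>n z. integral {\<alpha> n..\<beta> n} (G z))
        (\<lambda>z. integral {a..b} (G z)) sequentially"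
    proof (rule uniform_limitI)
      fix \<epsilon> :: real assume "\<epsilon> > 0"
      then have "eventually (\<lambda>n. M * (W (\<alpha> n) + (W b - W (\<beta> n))) < \<epsilon>) sequentially"
        using null by (simp add: order_tendsto_iff)
      then show "\<forall>\<^sub>F n in sequentially. \<forall>z\<in>ball x e.
          dist (integral {\<alpha> n..\<beta> n} (G z)) (integral {a..b} (G z)) < \<epsilon>"
        by eventually_elim (auto simp del: mem_ball simp: dist_norm intro: le_less_trans[OF diff])
    qed
    show ?thesis
    proof (rule holomorphic_uniform_sequence)
      show "(\<lambda>z. integral {\<alpha> n..\<beta> n} (G z)) holomorphic_on ball x e" for n
        using hol[of n] by simp
      fix y assume "y \<in> ball x e"
      then obtain d where "d > 0" "cball y d \<subseteq> ball x e"
        using open_contains_cball open_ball by blast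
      then show "\<exists>d. 0 < d \<and> cball y d \<subseteq> ball x e \<and> uniform_limit (cball y d)
          (\<lambda>n z. integral {\<alpha> n..\<beta> n} (G z)) (\<lambda>z. integral {a..b} (G z)) sequentially"
        using uniform_limit_on_subset[OF unif] by blast
    qed auto
  qed
  have "(\<lambda>z. integral {a..b} (G z)) analytic_on S"
    unfolding analytic_on_def using local \<open>open S\<close> open_contains_cball by meson
  then show ?thesis
    unfolding G_def by (rule analytic_imp_holomorphic)
qed

section \<open>The slit plane and the Jacobi integral\<close>

text \<open>The plane cut along the reals of modulus at least 1: the values of \<open>l\<close> for
  which the branch point 1 / l of (1 - l t)^(-h) avoids [-1, 1]. It is also the preimage of
  \<open>hyp2F1_domain\<close> under squaring.\<close>

definition slit_plane :: "complex set" where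
  "slit_plane = {z. Im z \<noteq> 0 \<or> \<bar>Re z\<bar> < 1}"

lemma open_slit_plane: "open slit_plane"
proof -
  have "slit_plane = - {z. Im z = 0} \<union> {z. \<bar>Re z\<bar> < 1}" by (auto simp: slit_plane_def)
  moreover have "open {z. \<bar>Re z\<bar> < 1}" by (intro open_Collect_less continuous_intros)
  moreover have "closed {z. Im z = 0}" by (intro closed_Collect_eq continuous_intros)
  ultimately show ?thesis by (metis open_Compl open_Un)
qed

lemma ball_subset_slit_plane: "norm z < 1 \<Longrightarrow> z \<in> slit_plane"
  using abs_Re_le_cmod[of z] by (auto simp: slit_plane_def)

lemma mult_in_slit_plane:
  assumes "z \<in> slit_plane" "t \<in> {-1..1}"
  shows "z * of_real t \<in> slit_plane"
proof (cases "Im z = 0")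
  case True
  then have "\<bar>Re z\<bar> < 1" using assms by (auto simp: slit_plane_def)
  moreover have "\<bar>Re z\<bar> * \<bar>t\<bar> \<le> \<bar>Re z\<bar> * 1" using assms by (intro mult_left_mono) auto
  ultimately show ?thesis using True by (auto simp: slit_plane_def abs_mult)
next
  case False
  then show ?thesis using assms by (cases "t = 0") (auto simp: slit_plane_def)
qed

lemma one_plus_slit_plane: "z \<in> slit_plane \<Longrightarrow> 1 + z \<notin> \<real>\<^sub>\<le>\<^sub>0"
  by (auto simp: slit_plane_def complex_nonpos_Reals_iff)

lemma one_minus_slit_plane: "z \<in> slit_plane \<Longrightarrow> 1 - z \<notin> \<real>\<^sub>\<le>\<^sub>0"
  by (auto simp: slit_plane_def complex_nonpos_Reals_iff)

text \<open>The symmetric Jacobi (Gegenbauer) weight. For h < 1 it is unbounded near the endpoints,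
  while at the endpoints themselves \<open>powr\<close> with base 0 gives the value 0.\<close>

definition jacobi_weight :: "real \<Rightarrow> real \<Rightarrow> real" where
  "jacobi_weight h t = (1 - t\<^sup>2) powr (h - 1)"

text \<open>The I(k, l) of the outline; after moving [-1, 1] to [0, 1] it is an Euler integral of
  Appell's function F1, up to elementary factors.\<close>

definition jacobi_integral :: "real \<Rightarrow> complex \<Rightarrow> complex \<Rightarrow> complex" where
  "jacobi_integral h k l = integral {-1..1} (\<lambda>t. of_real (jacobi_weight h t) *
     ((1 + k * of_real t) powr (- of_real h) * (1 - l * of_real t) powr (- of_real h)))"

lemma jacobi_weight_nonneg: "jacobi_weight h t \<ge> 0"
  by (simp add: jacobi_weight_def)

lemma continuous_on_jacobi_weight: "continuous_on {-1<..<1} (jacobi_weight h)"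
  unfolding jacobi_weight_def
proof (intro continuous_on_powr continuous_intros ballI)
  fix t :: real assume "t \<in> {-1<..<1}"
  then have "t\<^sup>2 < 1" by (simp add: abs_square_less_1 abs_less_iff)
  then show "1 - t\<^sup>2 \<noteq> 0" by simp
qed

text \<open>The substitution x = s^2 turns the integral over [0, 1] into half of Euler's Beta
  integral; reflection contributes the same amount from [-1, 0].\<close>

lemma has_integral_jacobi_even_moment:
  assumes "h > 0" "even n"
  shows "((\<lambda>t. jacobi_weight h t * t ^ n) has_integral Beta ((real n + 1) / 2) h) {-1..1}"
proof -
  define a where "a = (real n + 1) / 2"
  have "a > 0" by (simp add: a_def)
  define f where "f = (\<lambda>t. t powr (a - 1) * (1 - t) powr (h - 1))"
  have f: "(f has_integral Beta a h) {0..1}"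
    unfolding f_def by (rule has_integral_Beta_real) (use \<open>a > 0\<close> \<open>h > 0\<close> in auto)
  have img: "(\<lambda>s. s\<^sup>2) ` {0<..<1} = {0<..<1::real}"
  proof (intro equalityI subsetI)
    fix x :: real assume "x \<in> {0<..<1}"
    then have "x = (sqrt x)\<^sup>2" "sqrt x \<in> {0<..<1}" by auto
    then show "x \<in> (\<lambda>s. s\<^sup>2) ` {0<..<1}" by blast
  qed (auto simp: power_less_one_iff abs_square_less_1)
  have "f absolutely_integrable_on {0<..<1} \<and> integral {0<..<1} f = Beta a h"
  proof
    show "f absolutely_integrable_on {0<..<1}"
      unfolding absolutely_integrable_on_Icc_iff_Ioo[symmetric]
      by (rule nonnegative_absolutely_integrable_1) (use f in \<open>auto simp: f_def\<close>)
    show "integral {0<..<1} f = Beta a h"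
      using f by (simp add: integral_open_interval_real[symmetric] integral_unique)
  qed
  then have "f absolutely_integrable_on (\<lambda>s. s\<^sup>2) ` {0<..<1} \<and> integral ((\<lambda>s. s\<^sup>2) ` {0<..<1}) f = Beta a h"
    by (simp add: img)
  then have "(\<lambda>s. \<bar>2 * s\<bar> *\<^sub>R f (s\<^sup>2)) absolutely_integrable_on {0<..<1} \<and>
      integral {0<..<1} (\<lambda>s. \<bar>2 * s\<bar> *\<^sub>R f (s\<^sup>2)) = Beta a h"
    by (subst has_absolute_integral_change_of_variables_real)
      (auto intro!: derivative_eq_intros inj_onI simp: power2_eq_iff)
  then have "((\<lambda>s. \<bar>2 * s\<bar> *\<^sub>R f (s\<^sup>2)) has_integral Beta a h) {0<..<1}"
    using set_lebesgue_integral_eq_integral(1) has_integral_integral by metis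
  \<comment> \<open>Since 2 (a - 1) = n - 1, the factor \<open>s\<close> of the Jacobian completes
    the power to \<open>s ^ n\<close>.\<close>
  moreover have "\<bar>2 * s\<bar> *\<^sub>R f (s\<^sup>2) = 2 * (jacobi_weight h s * s ^ n)" if "s \<in> {0<..<1}" for s
  proof -
    have s: "s > 0" using that by simp
    have "s * (s\<^sup>2) powr (a - 1) = s powr 1 * s powr (2 * (a - 1))"
      using s by (simp add: powr_powr flip: powr_numeral)
    also have "\<dots> = s powr (1 + 2 * (a - 1))" by (rule powr_add[symmetric])
    also have "1 + 2 * (a - 1) = real n" by (simp add: a_def field_simps)
    also have "s powr real n = s ^ n" using s by (simp add: powr_realpow)
    finally have "s * (s\<^sup>2) powr (a - 1) = s ^ n" .
    then show ?thesis using s by (simp add: f_def jacobi_weight_def mult_ac)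
  qed
  ultimately have "((\<lambda>s. 2 * (jacobi_weight h s * s ^ n)) has_integral Beta a h) {0<..<1}"
    using has_integral_cong by (metis (no_types, lifting))
  then have "((\<lambda>s. 2 * (jacobi_weight h s * s ^ n)) has_integral Beta a h) {0..1}"
    by (simp add: has_integral_Icc_iff_Ioo)
  from has_integral_mult_right[OF this, of "1/2"]
  have half: "((\<lambda>s. jacobi_weight h s * s ^ n) has_integral Beta a h / 2) {0..1}" by simp
  have "((\<lambda>s. jacobi_weight h (- s) * (- s) ^ n) has_integral Beta a h / 2) {-1..-0}"
    by (rule has_integral_reflect_lemma_real[OF half])
  then have "((\<lambda>s. jacobi_weight h s * s ^ n) has_integral Beta a h / 2) {-1..0}"
    using \<open>even n\<close> by (simp add: jacobi_weight_def)
  from has_integral_combine[OF _ _ this half] show ?thesis by (simp add: a_def)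
qed

lemma jacobi_weight_integrable: "h > 0 \<Longrightarrow> jacobi_weight h integrable_on {-1..1}"
  using has_integral_jacobi_even_moment[of h 0] by auto

lemma jacobi_weight_times_continuous:
  fixes g :: "real \<Rightarrow> complex"
  assumes "h > 0" "continuous_on {-1..1} g"
  shows "(\<lambda>t. of_real (jacobi_weight h t) * g t) absolutely_integrable_on {-1..1}"
proof -
  have "jacobi_weight h absolutely_integrable_on {-1..1}"
    by (rule nonnegative_absolutely_integrable_1)
      (use assms jacobi_weight_integrable jacobi_weight_nonneg in auto)
  moreover have "bilinear (\<lambda>x y. of_real y * x :: complex)"
    by (auto simp: bilinear_def algebra_simps scaleR_conv_of_real intro!: linearI)
  moreover have "g \<in> borel_measurable (lebesgue_on {-1..1})"
    using assms(2) by (intro continuous_imp_measurable_on_sets_lebesgue) auto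
  moreover have "bounded (g ` {-1..1})"
    using assms(2) by (intro compact_imp_bounded compact_continuous_image) auto
  ultimately show ?thesis
    using absolutely_integrable_bounded_measurable_product[of "\<lambda>x y. of_real y * x" g "{-1..1}" "jacobi_weight h"]
    by simp
qed

lemma continuous_on_powr_const:
  fixes f :: "'a::topological_space \<Rightarrow> complex"
  assumes "continuous_on A f" "\<And>x. x \<in> A \<Longrightarrow> f x \<notin> \<real>\<^sub>\<le>\<^sub>0"
  shows "continuous_on A (\<lambda>x. f x powr c)"
proof (rule continuous_on_powr_complex)
  show "A \<subseteq> {z. 0 \<le> Re (f z) \<or> Im (f z) \<noteq> 0}"
    using assms(2) by (force simp: complex_nonpos_Reals_iff)
  show "0 < Re c" if "z \<in> A" "f z = 0" for z using assms(2)[OF that(1)] that(2) by simp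
qed (use assms in auto)

lemma jacobi_integral_integrand_absolutely_integrable:
  assumes "h > 0" "k \<in> slit_plane" "l \<in> slit_plane"
  shows "(\<lambda>t. of_real (jacobi_weight h t) *
     ((1 + k * of_real t) powr (- of_real h) * (1 - l * of_real t) powr (- of_real h)))
       absolutely_integrable_on {-1..1}"
proof (rule jacobi_weight_times_continuous[OF assms(1)])
  have "1 + k * of_real t \<notin> \<real>\<^sub>\<le>\<^sub>0" "1 - l * of_real t \<notin> \<real>\<^sub>\<le>\<^sub>0" if "t \<in> {-1..1}" for t
    using assms that mult_in_slit_plane one_plus_slit_plane one_minus_slit_plane by blast+
  then show "continuous_on {- 1..1} (\<lambda>t. (1 + k * of_real t) powr (- of_real h) *
      (1 - l * of_real t) powr (- of_real h))"
    by (intro continuous_on_mult continuous_on_powr_const) (auto intro!: continuous_intros)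
qed

text \<open>Values in the slit plane keep both bases off the branch cut for all \<open>t\<close>.
  Letting \<open>k\<close> and \<open>l\<close> be functions of one complex variable allows the
  one-variable identity theorem to be applied along any holomorphic curve of parameters.\<close>

lemma jacobi_integral_holomorphic:
  assumes "h > 0" "open S" and k: "k holomorphic_on S" "k ` S \<subseteq> slit_plane"
    and l: "l holomorphic_on S" "l ` S \<subseteq> slit_plane"
  shows "(\<lambda>z. jacobi_integral h (k z) (l z)) holomorphic_on S"
  unfolding jacobi_integral_def
proof (rule holomorphic_on_weighted_integral[where
    g' = "\<lambda>z t. (1 + k z * of_real t) powr (- of_real h) *
        (- of_real h * (1 - l z * of_real t) powr (- of_real h - 1) * - (deriv l z * of_real t)) +
      (- of_real h * (1 + k z * of_real t) powr (- of_real h - 1) * (deriv k z * of_real t)) *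
        (1 - l z * of_real t) powr (- of_real h)"])
  have slit: "k z \<in> slit_plane" "l z \<in> slit_plane" if "z \<in> S" for z
    using k l that by auto
  have nonpos: "1 + k z * of_real t \<notin> \<real>\<^sub>\<le>\<^sub>0" "1 - l z * of_real t \<notin> \<real>\<^sub>\<le>\<^sub>0"
    if "z \<in> S" "t \<in> {-1..1}" for z and t :: real
    using slit[OF that(1)] that mult_in_slit_plane one_plus_slit_plane one_minus_slit_plane by blast+
  have cont: "continuous_on (S \<times> {-1..1}) (\<lambda>p. f (fst p))" if "f holomorphic_on S" for f :: "complex \<Rightarrow> complex"
    using holomorphic_on_imp_continuous_on[OF that]
    by (rule continuous_on_compose2) (auto intro!: continuous_intros)
  have powr: "continuous_on (S \<times> {-1..1}) (\<lambda>p. (1 + k (fst p) * of_real (snd p)) powr c)"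
    "continuous_on (S \<times> {-1..1}) (\<lambda>p. (1 - l (fst p) * of_real (snd p)) powr c)" for c :: complex
    by (rule continuous_on_powr_const; use nonpos in
        \<open>auto intro!: continuous_intros cont[OF k(1)] cont[OF l(1)]\<close>)+
  show "continuous_on (S \<times> {-1..1}) (\<lambda>(z, t). (1 + k z * of_real t) powr (- of_real h) * (1 - l z * of_real t) powr (- of_real h))"
    unfolding case_prod_unfold by (intro continuous_on_mult powr)
  show "continuous_on (S \<times> {-1..1}) (\<lambda>(z, t). (1 + k z * of_real t) powr (- of_real h) *
        (- of_real h * (1 - l z * of_real t) powr (- of_real h - 1) * - (deriv l z * of_real t)) +
      (- of_real h * (1 + k z * of_real t) powr (- of_real h - 1) * (deriv k z * of_real t)) *
        (1 - l z * of_real t) powr (- of_real h))"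
    unfolding case_prod_unfold
    by (intro continuous_on_add continuous_on_mult continuous_on_minus continuous_on_const
        continuous_on_of_real continuous_on_snd continuous_on_id powr
        cont[OF holomorphic_deriv[OF k(1) \<open>open S\<close>]] cont[OF holomorphic_deriv[OF l(1) \<open>open S\<close>]])
  fix z assume z: "z \<in> S"
  have D: "(k has_field_derivative deriv k z) (at z)" "(l has_field_derivative deriv l z) (at z)"
    using k l z \<open>open S\<close> holomorphic_derivI by blast+
  show "((\<lambda>z. (1 + k z * of_real t) powr (- of_real h) * (1 - l z * of_real t) powr (- of_real h))
       has_field_derivative (1 + k z * of_real t) powr (- of_real h) *
        (- of_real h * (1 - l z * of_real t) powr (- of_real h - 1) * - (deriv l z * of_real t)) +
      (- of_real h * (1 + k z * of_real t) powr (- of_real h - 1) * (deriv k z * of_real t)) *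
        (1 - l z * of_real t) powr (- of_real h)) (at z)" if "t \<in> {-1..1}" for t :: real
  proof (rule DERIV_mult')
    show "((\<lambda>z. (1 + k z * of_real t) powr (- of_real h)) has_field_derivative
        - of_real h * (1 + k z * of_real t) powr (- of_real h - 1) * (deriv k z * of_real t)) (at z)"
      using nonpos[OF z that]
      by (intro DERIV_chain2[OF has_field_derivative_powr]) (auto intro!: derivative_eq_intros D)
    show "((\<lambda>z. (1 - l z * of_real t) powr (- of_real h)) has_field_derivative
        - of_real h * (1 - l z * of_real t) powr (- of_real h - 1) * - (deriv l z * of_real t)) (at z)"
      using nonpos[OF z that]
      by (intro DERIV_chain2[OF has_field_derivative_powr]) (auto intro!: derivative_eq_intros D)
  qed
  show "(\<lambda>t. of_real (jacobi_weight h t) * ((1 + k z * of_real t) powr (- of_real h) *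
      (1 - l z * of_real t) powr (- of_real h))) integrable_on {-1..1}"
    using jacobi_integral_integrand_absolutely_integrable[OF \<open>h > 0\<close> slit(1)[OF z] slit(2)[OF z]]
    by (rule set_lebesgue_integral_eq_integral(1))
qed (use assms jacobi_weight_integrable jacobi_weight_nonneg continuous_on_jacobi_weight in auto)

lemma one_plus_mult_pos:
  fixes k t :: real
  assumes "\<bar>k\<bar> < 1" "\<bar>t\<bar> \<le> 1"
  shows "1 + k * t > 0"
proof -
  have "\<bar>k * t\<bar> \<le> \<bar>k\<bar> * 1" unfolding abs_mult using assms by (intro mult_left_mono) auto
  then show ?thesis using assms by linarith
qed

text \<open>For real parameters both bases are positive, so the principal powers are real. The
  resulting real integral is the form in which the Moebius substitution is carried out.\<close>

lemma jacobi_integral_of_real: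
  fixes k l :: real
  assumes "h > 0" "\<bar>k\<bar> < 1" "\<bar>l\<bar> < 1"
  defines "f \<equiv> \<lambda>t. jacobi_weight h t * ((1 + k * t) powr (- h) * (1 - l * t) powr (- h))"
  shows "f absolutely_integrable_on {-1..1}"
    and "jacobi_integral h (of_real k) (of_real l) = of_real (integral {-1..1} f)"
proof -
  have eq: "of_real (jacobi_weight h t) *
     ((1 + of_real k * of_real t) powr (- of_real h) * (1 - of_real l * of_real t) powr (- of_real h)) =
     complex_of_real (f t)" if "t \<in> {-1..1}" for t
  proof -
    have "1 + k * t \<ge> 0" "1 + (-l) * t \<ge> 0"
      by (rule less_imp_le[OF one_plus_mult_pos]; use that assms in auto)+
    then show ?thesis
      using powr_of_real[of "1 + k * t" "- h"] powr_of_real[of "1 - l * t" "- h"] by (simp add: f_def)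
  qed
  have slit: "complex_of_real k \<in> slit_plane" "complex_of_real l \<in> slit_plane"
    using assms by (auto simp: slit_plane_def)
  have int: "(\<lambda>t. complex_of_real (f t)) integrable_on {-1..1}"
    by (rule integrable_eq[OF set_lebesgue_integral_eq_integral(1)[OF jacobi_integral_integrand_absolutely_integrable[OF \<open>h > 0\<close> slit]]])
      (use eq in auto)
  have "f integrable_on {-1..1}"
    using integrable_linear[OF int bounded_linear_Re] by (simp add: o_def)
  then show "f absolutely_integrable_on {-1..1}"
    by (intro nonnegative_absolutely_integrable_1) (auto simp: f_def jacobi_weight_nonneg)
  have "jacobi_integral h (of_real k) (of_real l) = integral {-1..1} (\<lambda>t. complex_of_real (f t))"
    unfolding jacobi_integral_def by (rule integral_cong) (use eq in auto)
  also have "\<dots> = of_real (integral {-1..1} f)"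
    using has_integral_of_real[OF integrable_integral[OF \<open>f integrable_on {-1..1}\<close>]]
    by (rule integral_unique)
  finally show "jacobi_integral h (of_real k) (of_real l) = of_real (integral {-1..1} f)" .
qed

section \<open>The Moebius substitution for real parameters\<close>

text \<open>The same map with \<open>- k\<close> is the inverse. Both preserve the interval, because
  1 - x and 1 + x equal (1 - k) (1 - t) and (1 + k) (1 + t), each divided by 1 + k t.\<close>

lemma moebius_image:
  fixes k :: real
  assumes "\<bar>k\<bar> < 1"
  shows "(\<lambda>t. (t + k) / (1 + k * t)) ` {-1<..<1} = {-1<..<1}"
    and "inj_on (\<lambda>t. (t + k) / (1 + k * t)) {-1<..<1}"
proof -
  have maps: "(t + c) / (1 + c * t) \<in> {-1<..<1}" if "\<bar>c\<bar> < 1" "t \<in> {-1<..<1}" for c t :: real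
  proof -
    have P: "1 + c * t > 0" using that by (intro one_plus_mult_pos) auto
    have "(1 - c) * (1 - t) > 0" "(1 + c) * (1 + t) > 0" using that by auto
    then show ?thesis using P by (simp add: field_simps)
  qed
  have inv: "((t + k) / (1 + k * t) + - k) / (1 + - k * ((t + k) / (1 + k * t))) = t"
    if "\<bar>k\<bar> < 1" "t \<in> {-1<..<1}" for k t :: real
  proof -
    have P: "1 + k * t > 0" using that by (intro one_plus_mult_pos) auto
    have "k\<^sup>2 < 1" using that(1) by (simp add: abs_square_less_1)
    have "(t + k) / (1 + k * t) + - k = t * (1 - k\<^sup>2) / (1 + k * t)"
      "1 + - k * ((t + k) / (1 + k * t)) = (1 - k\<^sup>2) / (1 + k * t)"
      using P by (simp_all add: field_simps power2_eq_square)
    then show ?thesis using P \<open>k\<^sup>2 < 1\<close> by simp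
  qed
  show "inj_on (\<lambda>t. (t + k) / (1 + k * t)) {-1<..<1}"
    by (rule inj_on_inverseI) (rule inv[OF assms])
  show "(\<lambda>t. (t + k) / (1 + k * t)) ` {-1<..<1} = {-1<..<1}"
  proof (intro equalityI subsetI)
    fix x :: real assume x: "x \<in> {-1<..<1}"
    have "x = ((x + - k) / (1 + - k * x) + k) / (1 + k * ((x + - k) / (1 + - k * x)))"
      using inv[of "- k" x] assms x by simp
    moreover have "(x + - k) / (1 + - k * x) \<in> {-1<..<1}"
      using maps[of "- k" x] assms x by simp
    ultimately show "x \<in> (\<lambda>t. (t + k) / (1 + k * t)) ` {-1<..<1}" by blast
  qed (use maps assms in auto)
qed

text \<open>Substitute x = (t + k) / (1 + k t) in I(0, \<eta>). With P = 1 + k t and Q = 1 - l t one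
  has dx/dt = (1 - k^2) / P^2, 1 - x^2 = (1 - k^2) (1 - t^2) / P^2 and 1 - \<eta> x = (1 - k^2) Q /
  ((1 + k l) P).\<close>

lemma jacobi_integral_moebius_real:
  fixes k l :: real
  assumes h: "h > 0" and k: "\<bar>k\<bar> < 1" and l: "\<bar>l\<bar> < 1"
  shows "jacobi_integral h (of_real k) (of_real l) =
    (1 + of_real k * of_real l) powr (- of_real h) * jacobi_integral h 0 ((of_real k + of_real l) / (1 + of_real k * of_real l))"
proof -
  define \<eta> where "\<eta> = (k + l) / (1 + k * l)"
  define g where "g = (\<lambda>t. (t + k) / (1 + k * t))"
  define f where "f = (\<lambda>t. jacobi_weight h t * (1 - \<eta> * t) powr (- h))"
  define f' where "f' = (\<lambda>t. jacobi_weight h t * ((1 + k * t) powr (- h) * (1 - l * t) powr (- h)))"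
  have R: "1 + k * l > 0" using k l by (intro one_plus_mult_pos) auto
  \<comment> \<open>Divided by 1 + k l, these products are 1 - \<eta> and 1 + \<eta>.\<close>
  have "(1 - k) * (1 - l) > 0" "(1 + k) * (1 + l) > 0" using k l by auto
  then have \<eta>: "\<bar>\<eta>\<bar> < 1" using R by (simp add: \<eta>_def field_simps abs_less_iff)
  have f: "f absolutely_integrable_on {-1..1}" "jacobi_integral h 0 (of_real \<eta>) = of_real (integral {-1..1} f)"
    using jacobi_integral_of_real[of h 0 \<eta>] h \<eta> by (simp_all add: f_def)
  have f': "jacobi_integral h (of_real k) (of_real l) = of_real (integral {-1..1} f')"
    unfolding f'_def by (rule jacobi_integral_of_real(2)[OF h k l])
  have "k\<^sup>2 < 1" using k by (simp add: abs_square_less_1)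
  have "f absolutely_integrable_on g ` {-1<..<1} \<and> integral (g ` {-1<..<1}) f = integral {-1..1} f"
    using f(1) moebius_image(1)[OF k]
    by (simp add: g_def absolutely_integrable_on_Icc_iff_Ioo integral_open_interval_real)
  then have "integral {-1<..<1} (\<lambda>t. \<bar>(1 - k\<^sup>2) / (1 + k * t)\<^sup>2\<bar> *\<^sub>R f (g t)) = integral {-1..1} f"
  proof (subst (asm) has_absolute_integral_change_of_variables_real[symmetric])
    show "inj_on g {-1<..<1}" unfolding g_def by (rule moebius_image(2)[OF k])
    fix t :: real assume "t \<in> {-1<..<1}"
    then have "1 + k * t > 0" using k by (intro one_plus_mult_pos) auto
    then show "(g has_field_derivative (1 - k\<^sup>2) / (1 + k * t)\<^sup>2) (at t within {-1<..<1})"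
      unfolding g_def by (auto intro!: derivative_eq_intros simp: field_simps power2_eq_square)
  qed auto
  also have "integral {-1<..<1} (\<lambda>t. \<bar>(1 - k\<^sup>2) / (1 + k * t)\<^sup>2\<bar> *\<^sub>R f (g t)) =
      integral {-1<..<1} (\<lambda>t. (1 + k * l) powr h * f' t)"
  proof (rule integral_cong)
    fix t :: real assume t: "t \<in> {-1<..<1}"
    define P Q m T where "P = 1 + k * t" and "Q = 1 - l * t" and "m = 1 - k\<^sup>2" and "T = 1 - t\<^sup>2"
    have "P > 0" "1 + (-l) * t > 0"
      unfolding P_def by (rule one_plus_mult_pos; use t k l in auto)+
    then have pos: "P > 0" "Q > 0" "m > 0" "T > 0"
      using t \<open>k\<^sup>2 < 1\<close> by (auto simp: Q_def m_def T_def abs_square_less_1 abs_less_iff)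
    have "1 - (g t)\<^sup>2 = (P\<^sup>2 - (t + k)\<^sup>2) / P\<^sup>2"
      using pos by (simp add: g_def P_def[symmetric] power_divide diff_divide_distrib)
    also have "P\<^sup>2 - (t + k)\<^sup>2 = T * m" by (simp add: P_def T_def m_def algebra_simps power2_eq_square)
    finally have 1: "1 - (g t)\<^sup>2 = T * m / P\<^sup>2" .
    have "1 - \<eta> * g t = ((1 + k * l) * P - (k + l) * (t + k)) / ((1 + k * l) * P)"
      using pos R by (simp add: g_def \<eta>_def P_def[symmetric] diff_divide_distrib)
    also have "(1 + k * l) * P - (k + l) * (t + k) = m * Q"
      by (simp add: P_def Q_def m_def algebra_simps power2_eq_square)
    finally have 2: "1 - \<eta> * g t = m * Q / ((1 + k * l) * P)" .
    \<comment> \<open>Logarithms reduce the identity to adding exponents: those of \<open>m\<close>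
      give 1 + (h - 1) - h = 0, those of \<open>P\<close> give -2 - 2 (h - 1) + h = -h.\<close>
    have "m / P\<^sup>2 = exp (ln m - 2 * ln P)"
      using pos by (simp add: exp_diff exp_double)
    then have "m / P\<^sup>2 * ((T * m / P\<^sup>2) powr (h - 1) * (m * Q / ((1 + k * l) * P)) powr (- h)) =
        (1 + k * l) powr h * (T powr (h - 1) * (P powr (- h) * Q powr (- h)))"
      using pos R
      by (simp add: powr_def ln_mult ln_div ln_realpow flip: exp_add) (simp add: algebra_simps)
    then show "\<bar>(1 - k\<^sup>2) / (1 + k * t)\<^sup>2\<bar> *\<^sub>R f (g t) = (1 + k * l) powr h * f' t"
      using pos by (simp add: f_def f'_def jacobi_weight_def 1 2 flip: P_def Q_def m_def T_def)
  qed
  also have "\<dots> = (1 + k * l) powr h * integral {-1..1} f'"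
    by (simp add: integral_open_interval_real)
  finally have "integral {-1..1} f' = (1 + k * l) powr (- h) * integral {-1..1} f"
    using R by (simp add: powr_minus field_simps)
  moreover have "(1 + of_real k * of_real l) powr (- of_real h) = complex_of_real ((1 + k * l) powr (- h))"
    using powr_of_real[of "1 + k * l" "- h"] R by simp
  moreover have "(of_real k + of_real l) / (1 + of_real k * of_real l) = complex_of_real \<eta>"
    by (simp add: \<eta>_def)
  ultimately show ?thesis by (simp add: f f')
qed

section \<open>Analytic continuation of the Moebius identity\<close>

text \<open>The difference of the two sides of the Moebius identity along a curve of parameters.
  Each continuation below applies the identity theorem to this function.\<close>

lemma jacobi_integral_moebius_holomorphic:
  assumes "h > 0" "open S" and k: "k holomorphic_on S" "k ` S \<subseteq> slit_plane"
    and l: "l holomorphic_on S" "l ` S \<subseteq> slit_plane"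
    and "\<And>z. z \<in> S \<Longrightarrow> 1 + k z * l z \<notin> \<real>\<^sub>\<le>\<^sub>0"
    and "\<And>z. z \<in> S \<Longrightarrow> (k z + l z) / (1 + k z * l z) \<in> slit_plane"
  shows "(\<lambda>z. jacobi_integral h (k z) (l z) - (1 + k z * l z) powr (- of_real h) *
           jacobi_integral h 0 ((k z + l z) / (1 + k z * l z))) holomorphic_on S"
proof -
  have "(\<lambda>z. (k z + l z) / (1 + k z * l z)) holomorphic_on S"
    using assms(7) by (intro holomorphic_intros k l) force
  then have "(\<lambda>z. jacobi_integral h 0 ((k z + l z) / (1 + k z * l z))) holomorphic_on S"
    using assms(1,2,8) by (intro jacobi_integral_holomorphic[where k = "\<lambda>_. 0"]) (auto simp: slit_plane_def)
  moreover have "(\<lambda>z. (1 + k z * l z) powr (- of_real h)) holomorphic_on S"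
    using assms(7) by (intro holomorphic_intros k l) auto
  ultimately show ?thesis
    by (intro holomorphic_on_diff[OF jacobi_integral_holomorphic[OF assms(1-6)]] holomorphic_on_mult)
qed

text \<open>The radius 1/3 suffices: |k l| is at most 1/9, so the quotient has modulus below (2/3) /
  (8/9) = 3/4.\<close>

lemma slit_plane_moebius_small:
  assumes "norm k < 1 / 3" "norm l < 1 / 3"
  shows "1 + k * l \<notin> \<real>\<^sub>\<le>\<^sub>0" "(k + l) / (1 + k * l) \<in> slit_plane"
proof -
  have "norm (k * l) \<le> 1 / 3 * (1 / 3)"
    unfolding norm_mult using assms by (intro mult_mono) auto
  then have kl: "norm (k * l) \<le> 1 / 9" by simp
  then have "k * l \<in> slit_plane" by (intro ball_subset_slit_plane) simp
  then show "1 + k * l \<notin> \<real>\<^sub>\<le>\<^sub>0" by (rule one_plus_slit_plane)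
  have "norm (1 + k * l) \<ge> 8 / 9" using norm_diff_ineq[of 1 "k * l"] kl by simp
  moreover have "norm (k + l) < 2 / 3" using norm_triangle_ineq[of k l] assms by simp
  ultimately show "(k + l) / (1 + k * l) \<in> slit_plane"
    by (intro ball_subset_slit_plane) (auto simp: norm_divide divide_less_eq)
qed

lemma analytic_continuation_from_reals:
  assumes "f holomorphic_on ball 0 r" "r > 0"
    and "\<And>x. \<bar>x\<bar> < r \<Longrightarrow> f (complex_of_real x) = 0" and "norm z < r"
  shows "f z = 0"
proof (rule analytic_continuation[of f "ball 0 r" "complex_of_real ` {x. \<bar>x\<bar> < r}" 0])
  show "0 islimpt complex_of_real ` {x. \<bar>x\<bar> < r}"
    unfolding islimpt_approachable
  proof (intro allI impI)
    fix e :: real assume "e > 0"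
    define x where "x = min (e / 2) (r / 2)"
    have "x > 0" "x < e" "x < r" using \<open>e > 0\<close> \<open>r > 0\<close> by (auto simp: x_def min_def)
    then show "\<exists>x'\<in>complex_of_real ` {x. \<bar>x\<bar> < r}. x' \<noteq> 0 \<and> dist x' 0 < e"
      by (intro bexI[of _ "of_real x"]) auto
  qed
qed (use assms in auto)

text \<open>The two variables are continued one after the other: first \<open>l\<close> away from
  the reals while \<open>k\<close> is real, then \<open>k\<close> with the complex \<open>l\<close>
  fixed.\<close>

lemma jacobi_integral_moebius_small:
  assumes h: "h > 0" and "norm k < 1 / 3" "norm l < 1 / 3"
  shows "jacobi_integral h k l = (1 + k * l) powr (- of_real h) * jacobi_integral h 0 ((k + l) / (1 + k * l))"
proof -
  have real_left: "jacobi_integral h (of_real x) l = (1 + of_real x * l) powr (- of_real h) * jacobi_integral h 0 ((of_real x + l) / (1 + of_real x * l))"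
    if x: "\<bar>x\<bar> < 1 / 3" and l: "norm l < 1 / 3" for x l
  proof -
    have "jacobi_integral h (of_real x) l - (1 + of_real x * l) powr (- of_real h) * jacobi_integral h 0 ((of_real x + l) / (1 + of_real x * l)) = 0"
    proof (rule analytic_continuation_from_reals[OF jacobi_integral_moebius_holomorphic[where k = "\<lambda>_. of_real x" and l = "\<lambda>z. z"]])
      show "jacobi_integral h (of_real x) (of_real y) - (1 + of_real x * of_real y) powr (- of_real h) *
          jacobi_integral h 0 ((of_real x + of_real y) / (1 + of_real x * of_real y)) = 0" if "\<bar>y\<bar> < 1 / 3" for y
        using jacobi_integral_moebius_real[of h x y] h x that by simp
      show "1 + of_real x * z \<notin> \<real>\<^sub>\<le>\<^sub>0" "(of_real x + z) / (1 + of_real x * z) \<in> slit_plane"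
        if "z \<in> ball 0 (1 / 3)" for z
        using slit_plane_moebius_small[of "of_real x" z] x that by simp_all
    qed (use h x l in \<open>auto intro!: ball_subset_slit_plane\<close>)
    then show ?thesis by simp
  qed
  have "jacobi_integral h k l - (1 + k * l) powr (- of_real h) * jacobi_integral h 0 ((k + l) / (1 + k * l)) = 0"
  proof (rule analytic_continuation_from_reals[OF jacobi_integral_moebius_holomorphic[where k = "\<lambda>z. z" and l = "\<lambda>_. l"]])
    show "1 + z * l \<notin> \<real>\<^sub>\<le>\<^sub>0" "(z + l) / (1 + z * l) \<in> slit_plane" if "z \<in> ball 0 (1 / 3)" for z
      using slit_plane_moebius_small[of z l] assms(3) that by simp_all
  qed (use assms real_left in \<open>auto intro!: ball_subset_slit_plane\<close>)
  then show ?thesis by simp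
qed

text \<open>Replace (k, l) by (z k, z l). The identity holds for small \<open>z\<close>, and
  \<open>seg\<close> says that nothing singular is met on the way from z = 0 to z = 1.\<close>

lemma jacobi_integral_moebius:
  assumes h: "h > 0"
    and seg: "\<And>r. r \<in> {0..1} \<Longrightarrow> of_real r * k \<in> slit_plane \<and> of_real r * l \<in> slit_plane \<and>
      1 + (of_real r * k) * (of_real r * l) \<notin> \<real>\<^sub>\<le>\<^sub>0 \<and>
      (of_real r * k + of_real r * l) / (1 + (of_real r * k) * (of_real r * l)) \<in> slit_plane"
  shows "jacobi_integral h k l = (1 + k * l) powr (- of_real h) * jacobi_integral h 0 ((k + l) / (1 + k * l))"
proof -
  \<comment> \<open>\<open>S\<close> collects the scalings at which both sides are holomorphic. The
    identity theorem needs a connected open set, hence the component \<open>C\<close> of 0, which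
    contains 1 because [0, 1] is connected.\<close>
  define S where "S = {z. z * k \<in> slit_plane \<and> z * l \<in> slit_plane \<and> 1 + (z * k) * (z * l) \<notin> \<real>\<^sub>\<le>\<^sub>0 \<and>
    (z * k + z * l) / (1 + (z * k) * (z * l)) \<in> slit_plane}"
  define C where "C = connected_component_set S 0"
  have "open S"
  proof -
    define V where "V = {z. 1 + (z * k) * (z * l) \<notin> \<real>\<^sub>\<le>\<^sub>0}"
    have V: "V = (\<lambda>z. 1 + (z * k) * (z * l)) -` (- \<real>\<^sub>\<le>\<^sub>0)" by (auto simp: V_def)
    have "open V" unfolding V by (intro open_vimage continuous_intros) auto
    moreover have "continuous_on V (\<lambda>z. (z * k + z * l) / (1 + (z * k) * (z * l)))"
      by (intro continuous_intros) (force simp: V_def)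
    ultimately have "open (V \<inter> (\<lambda>z. (z * k + z * l) / (1 + (z * k) * (z * l))) -` slit_plane)"
      using open_slit_plane continuous_open_preimage by blast
    moreover have "open ((\<lambda>z. z * k) -` slit_plane)" "open ((\<lambda>z. z * l) -` slit_plane)"
      by (intro open_vimage continuous_intros open_slit_plane)+
    moreover have "S = (\<lambda>z. z * k) -` slit_plane \<inter> (\<lambda>z. z * l) -` slit_plane \<inter>
        (V \<inter> (\<lambda>z. (z * k + z * l) / (1 + (z * k) * (z * l))) -` slit_plane)"
      by (auto simp: S_def V_def)
    ultimately show ?thesis by auto
  qed
  then have "open C" by (simp add: C_def open_connected_component)
  have unit: "complex_of_real ` {0..1} \<subseteq> S"
    using seg by (auto simp: S_def)
  have "complex_of_real ` {0..1} \<subseteq> C"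
    unfolding C_def
    by (rule connected_component_maximal)
      (use unit in \<open>auto intro!: connected_continuous_image continuous_intros image_eqI[of _ _ 0]\<close>)
  then have C: "0 \<in> C" "1 \<in> C" by (force simp: image_iff)+
  have "C \<subseteq> S" unfolding C_def by (rule connected_component_subset)
  obtain e where e: "e > 0" "ball 0 e \<subseteq> C" using C(1) \<open>open C\<close> open_contains_ball by blast
  \<comment> \<open>Small enough for \<open>z * k\<close> and \<open>z * l\<close> to have modulus
    below 1/3; the summand 1 keeps the denominator positive when \<open>k\<close> and
    \<open>l\<close> vanish.\<close>
  define d where "d = min e (1 / (3 * (norm k + norm l + 1)))"
  have "d > 0" using e by (auto simp: d_def intro!: divide_pos_pos add_nonneg_pos)
  have small: "norm (z * k) < 1 / 3" "norm (z * l) < 1 / 3" if "z \<in> ball 0 d" for z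
  proof -
    have "norm k + norm l + 1 > 0" by (intro add_nonneg_pos) auto
    have "norm z < 1 / (3 * (norm k + norm l + 1))" using that by (simp add: d_def)
    then have "norm z * (norm k + norm l + 1) < 1 / 3"
      using \<open>norm k + norm l + 1 > 0\<close> by (simp add: field_simps)
    moreover have "norm z * norm k \<le> norm z * (norm k + norm l + 1)"
      "norm z * norm l \<le> norm z * (norm k + norm l + 1)"
      by (intro mult_left_mono; simp)+
    ultimately show "norm (z * k) < 1 / 3" "norm (z * l) < 1 / 3"
      unfolding norm_mult by linarith+
  qed
  have "jacobi_integral h (1 * k) (1 * l) - (1 + (1 * k) * (1 * l)) powr (- of_real h) *
      jacobi_integral h 0 ((1 * k + 1 * l) / (1 + (1 * k) * (1 * l))) = 0"
  proof (rule analytic_continuation[OF jacobi_integral_moebius_holomorphic[where k = "\<lambda>z. z * k" and l = "\<lambda>z. z * l" and S = C]])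
    show "connected C" by (simp add: C_def)
    show "(0::complex) islimpt ball 0 d" using \<open>d > 0\<close> by (simp add: islimpt_ball)
    show "ball 0 d \<subseteq> C" using e by (auto simp: d_def)
    show "jacobi_integral h (z * k) (z * l) - (1 + (z * k) * (z * l)) powr (- of_real h) *
      jacobi_integral h 0 ((z * k + z * l) / (1 + (z * k) * (z * l))) = 0" if "z \<in> ball 0 d" for z
      using jacobi_integral_moebius_small[OF h small[OF that]] by simp
  qed (use h \<open>open C\<close> C \<open>C \<subseteq> S\<close> in \<open>auto simp: S_def intro!: holomorphic_intros\<close>)
  then show ?thesis by simp
qed

section \<open>Identification with the hypergeometric function\<close>

lemma jacobi_integral_zero_minus: "jacobi_integral h 0 (- z) = jacobi_integral h 0 z"
proof -
  have "jacobi_integral h 0 z = integral {-1..1} (\<lambda>t. of_real (jacobi_weight h (- t)) *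
      ((1 + 0 * of_real (- t)) powr (- of_real h) * (1 - z * of_real (- t)) powr (- of_real h)))"
    unfolding jacobi_integral_def by (subst Henstock_Kurzweil_Integration.integral_reflect_real[symmetric]) simp
  then show ?thesis by (simp add: jacobi_integral_def jacobi_weight_def)
qed

text \<open>I(0, z) is even in \<open>z\<close>, so it depends only on the square and the choice of
  a square root is immaterial.\<close>

lemma jacobi_integral_zero_cong: "z\<^sup>2 = w\<^sup>2 \<Longrightarrow> jacobi_integral h 0 z = jacobi_integral h 0 w"
  by (auto simp: power2_eq_iff jacobi_integral_zero_minus)

lemma slit_plane_if_square:
  assumes "z\<^sup>2 \<in> hyp2F1_domain"
  shows "z \<in> slit_plane"
proof (rule ccontr)
  assume "z \<notin> slit_plane"
  then have "Im z = 0" "1 \<le> \<bar>Re z\<bar>" by (auto simp: slit_plane_def)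
  then have "z\<^sup>2 = complex_of_real ((Re z)\<^sup>2)" "1 \<le> (Re z)\<^sup>2"
    using abs_le_square_iff[of 1 "Re z"] by (auto simp: complex_eq_iff power2_eq_square)
  then show False using assms by (auto simp: hyp2F1_domain_def simp del: of_real_power)
qed

lemma has_integral_jacobi_moment:
  assumes "h > 0"
  shows "((\<lambda>t. jacobi_weight h t * t ^ n) has_integral (if even n then Beta ((real n + 1) / 2) h else 0)) {-1..1}"
proof (cases "even n")
  case True
  then show ?thesis using has_integral_jacobi_even_moment[OF assms] by simp
next
  case odd: False
  define f where "f = (\<lambda>t. jacobi_weight h t * t ^ n)"
  have "(\<lambda>t. Re (of_real (jacobi_weight h t) * of_real (t ^ n))) integrable_on {-1..1}"
    using integrable_linear[OF set_lebesgue_integral_eq_integral(1)[OF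
        jacobi_weight_times_continuous[of h "\<lambda>t. of_real (t ^ n)"]] bounded_linear_Re] assms
    by (simp add: o_def continuous_intros)
  then have I: "(f has_integral integral {-1..1} f) {-1..1}"
    by (auto simp: f_def)
  have "((\<lambda>t. f (- t)) has_integral integral {-1..1} f) {-1..- (- 1)}"
    by (rule has_integral_reflect_lemma_real[OF I])
  then have pos: "((\<lambda>t. - f t) has_integral integral {-1..1} f) {-1..1}"
    using odd by (simp add: f_def jacobi_weight_def)
  have "integral {-1..1} f = - integral {-1..1} f"
    by (rule has_integral_unique[OF pos has_integral_neg[OF I]])
  then have "integral {-1..1} f = 0" by simp
  then show ?thesis using I odd by (simp add: f_def)
qed

text \<open>The binomial series is integrated term by term. Since |t| is at most 1, all partial sums
  are bounded by the absolute sum \<open>C\<close> at t = 1, and \<open>C\<close> times the weight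
  is an integrable majorant.\<close>

lemma jacobi_integral_zero_sums:
  assumes "h > 0" "norm z < 1"
  shows "(\<lambda>n. (- of_real h gchoose n) * (- z) ^ n *
    of_real (if even n then Beta ((real n + 1) / 2) h else 0)) sums jacobi_integral h 0 z"
proof -
  define w where "w = - z"
  define c where "c = (\<lambda>n. - complex_of_real h gchoose n)"
  define m where "m = (\<lambda>n. if even n then Beta ((real n + 1) / 2) h else 0)"
  define f where "f = (\<lambda>k t. of_real (jacobi_weight h t) * (\<Sum>n<k. c n * (w * of_real t) ^ n))"
  \<comment> \<open>Convergence at a radius strictly beyond |z| yields absolute convergence at
    \<open>w\<close>.\<close>
  obtain r where r: "norm z < r" "r < 1" using assms(2) dense by blast
  have "summable (\<lambda>n. c n * of_real r ^ n)"
    unfolding c_def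
    by (rule sums_summable[OF gen_binomial_complex]) (use r norm_ge_zero[of z] in \<open>simp del: norm_ge_zero\<close>)
  then have abs: "summable (\<lambda>n. norm (c n * w ^ n))"
    by (rule powser_insidea) (use r norm_ge_zero[of z] in \<open>simp add: w_def del: norm_ge_zero\<close>)
  define C where "C = (\<Sum>n. norm (c n * w ^ n))"
  have f: "(f k has_integral (\<Sum>n<k. c n * w ^ n * of_real (m n))) {-1..1}" for k
  proof -
    have "((\<lambda>t. \<Sum>n<k. c n * w ^ n * of_real (jacobi_weight h t * t ^ n))
        has_integral (\<Sum>n<k. c n * w ^ n * of_real (m n))) {-1..1}"
      unfolding m_def
      by (intro has_integral_sum has_integral_mult_right has_integral_of_real
          has_integral_jacobi_moment assms) auto
    then show ?thesis
      by (rule has_integral_eq[rotated]) (simp add: f_def sum_distrib_left mult_ac power_mult_distrib)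
  qed
  have dominated: "norm (f k t) \<le> C * jacobi_weight h t" if "t \<in> {-1..1}" for k t
  proof -
    have "norm (\<Sum>n<k. c n * (w * of_real t) ^ n) \<le> (\<Sum>n<k. norm (c n * w ^ n))"
    proof (rule sum_norm_le)
      fix n
      have "\<bar>t\<bar> ^ n \<le> 1" using that by (intro power_le_one) auto
      then have "norm (c n * w ^ n) * \<bar>t\<bar> ^ n \<le> norm (c n * w ^ n) * 1"
        by (intro mult_left_mono) auto
      then show "norm (c n * (w * of_real t) ^ n) \<le> norm (c n * w ^ n)"
        by (simp add: norm_mult norm_power power_mult_distrib mult_ac)
    qed
    also have "\<dots> \<le> C" unfolding C_def by (rule sum_le_suminf[OF abs]) auto
    finally show ?thesis
      using jacobi_weight_nonneg[of h t] by (simp add: f_def norm_mult mult.commute[of C] mult_left_mono)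
  qed
  have conv: "(\<lambda>k. f k t) \<longlonglongrightarrow> of_real (jacobi_weight h t) *
      ((1 + 0 * of_real t) powr (- of_real h) * (1 - z * of_real t) powr (- of_real h))"
    if "t \<in> {-1..1}" for t
  proof -
    have "norm (z * of_real t) \<le> norm z * 1"
      unfolding norm_mult using that by (intro mult_left_mono) auto
    then have "norm (w * of_real t) < 1" using assms by (simp add: w_def norm_mult)
    from gen_binomial_complex[OF this, of "- of_real h"] show ?thesis
      unfolding f_def c_def sums_def by (intro tendsto_mult tendsto_const) (simp add: w_def)
  qed
  have "(\<lambda>k. integral {-1..1} (f k)) \<longlonglongrightarrow> jacobi_integral h 0 z"
    unfolding jacobi_integral_def
  proof (rule dominated_convergence(2)[OF _ _ dominated conv])
    show "(\<lambda>t. C * jacobi_weight h t) integrable_on {-1..1}"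
      using integrable_cmul[OF jacobi_weight_integrable[OF assms(1)], of C] by simp
  qed (use f in auto)
  then show ?thesis
    unfolding sums_def integral_unique[OF f] by (simp only: c_def m_def w_def)
qed

text \<open>The binomial coefficient is (h)_(2n) / (2n)!. Pochhammer duplication gives (h)_(2n) =
  4^n (h/2)_n (h/2 + 1/2)_n and (2n)! = 4^n (1/2)_n n!, and the moment is Beta(1/2, h) (1/2)_n / (h
  + 1/2)_n, so 4^n and (1/2)_n cancel.\<close>

lemma binomial_even_moment_eq_hypergeo_coefficient:
  assumes h: "h > 0"
  shows "(- of_real h gchoose (2 * n)) * complex_of_real (Beta ((real (2 * n) + 1) / 2) h) =
    of_real (Beta (1 / 2) h) * fps_nth (fps_hypergeo [of_real h / 2, of_real h / 2 + 1 / 2] [of_real h + 1 / 2] 1) n"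
proof -
  define P where "P = (\<lambda>x::real. pochhammer x n)"
  have pos: "P x > 0" if "x > 0" for x using that by (simp add: P_def pochhammer_pos)
  have nonpos: "x \<notin> \<int>\<^sub>\<le>\<^sub>0" if "x > 0" for x :: real
    using that by (auto elim!: nonpos_Ints_cases)
  have Gamma: "Gamma (x + real n) = P x * Gamma x" if "x > 0" for x
    using pochhammer_Gamma[OF nonpos[OF that], of n] Gamma_real_pos[OF that] by (simp add: P_def)
  have "(real (2 * n) + 1) / 2 = 1 / 2 + real n" "1 / 2 + real n + h = h + 1 / 2 + real n" by simp_all
  then have beta: "Beta ((real (2 * n) + 1) / 2) h = Beta (1 / 2) h * P (1 / 2) / P (h + 1 / 2)"
    using Gamma[of "1 / 2"] Gamma[of "h + 1 / 2"] h
    by (simp add: Beta_def add.commute field_simps)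
  \<comment> \<open>The second instance has base 2 (1/2) = 1, where the Pochhammer symbol is a
    factorial.\<close>
  have "pochhammer (2 * (h / 2)) (2 * n) = 2 ^ (2 * n) * P (h / 2) * P (h / 2 + 1 / 2)"
    "pochhammer (2 * (1 / 2)) (2 * n) = 2 ^ (2 * n) * P (1 / 2) * P (1 / 2 + 1 / 2)"
    unfolding P_def by (subst pochhammer_double; simp)+
  then have double: "pochhammer h (2 * n) = 2 ^ (2 * n) * P (h / 2) * P (h / 2 + 1 / 2)"
    "fact (2 * n) = 2 ^ (2 * n) * P (1 / 2) * fact n"
    by (simp_all add: P_def pochhammer_fact)
  have "- of_real h gchoose (2 * n) = complex_of_real (pochhammer h (2 * n) / fact (2 * n))"
    by (simp add: gbinomial_pochhammer pochhammer_of_real)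
  moreover have "fps_nth (fps_hypergeo [of_real h / 2, of_real h / 2 + 1 / 2] [of_real h + 1 / 2] 1) n =
      complex_of_real (P (h / 2) * P (h / 2 + 1 / 2) / (P (h + 1 / 2) * fact n))"
    by (simp add: P_def flip: pochhammer_of_real)
  moreover have "pochhammer h (2 * n) / fact (2 * n) * Beta ((real (2 * n) + 1) / 2) h =
      Beta (1 / 2) h * (P (h / 2) * P (h / 2 + 1 / 2) / (P (h + 1 / 2) * fact n))"
    unfolding double beta using pos[of "1 / 2"] by (simp add: field_simps)
  ultimately show ?thesis by (simp only: of_real_mult[symmetric])
qed

text \<open>By uniqueness of the continuation it suffices that F(y) = I(0, sqrt y) / B is
  holomorphic on the cut plane and has the hypergeometric expansion at 0.\<close>

lemma jacobi_integral_zero_hyp2F1: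
  assumes h: "h > 0" and z: "z\<^sup>2 \<in> hyp2F1_domain"
  shows "jacobi_integral h 0 z = of_real (Beta (1 / 2) h) *
    hyp2F1 (of_real h / 2) (of_real h / 2 + 1 / 2) (of_real h + 1 / 2) (z\<^sup>2)"
proof -
  define B where "B = complex_of_real (Beta (1 / 2) h)"
  define H where "H = fps_hypergeo [of_real h / 2, of_real h / 2 + 1 / 2] [of_real h + 1 / 2] (1 :: complex)"
  define F where "F = (\<lambda>y. jacobi_integral h 0 (csqrt y) / B)"
  have "Beta (1 / 2) h > 0" using h by (simp add: Beta_def Gamma_real_pos)
  then have "B \<noteq> 0" by (simp add: B_def)
  have sums: "(\<lambda>n. fps_nth H n * y ^ n) sums F y" if "norm y < 1" for y
  proof -
    define s where "s = csqrt y"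
    have "norm s ^ 2 < 1" using that unfolding s_def by (simp flip: norm_power)
    then have "norm s < 1" by (simp add: power_less_one_iff)
    define a where "a = (\<lambda>n. (- of_real h gchoose n) * (- s) ^ n *
      of_real (if even n then Beta ((real n + 1) / 2) h else 0))"
    have "a sums jacobi_integral h 0 s" unfolding a_def by (rule jacobi_integral_zero_sums[OF h \<open>norm s < 1\<close>])
    moreover have "a n = 0" if "n \<notin> range (\<lambda>n. 2 * n)" for n
      using that by (auto simp: a_def elim!: evenE)
    \<comment> \<open>The odd terms vanish, and the even powers of \<open>s\<close> are powers of
      \<open>y\<close>.\<close>
    ultimately have "(\<lambda>n. a (2 * n)) sums jacobi_integral h 0 s"
      by (subst sums_mono_reindex) (auto simp: strict_mono_def)
    moreover have "a (2 * n) = B * (fps_nth H n * y ^ n)" for n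
    proof -
      have "a (2 * n) = (- of_real h gchoose (2 * n)) * of_real (Beta ((real (2 * n) + 1) / 2) h) * y ^ n"
        by (simp add: a_def power_mult s_def)
      then show ?thesis by (simp only: binomial_even_moment_eq_hypergeo_coefficient[OF h] B_def H_def mult.assoc)
    qed
    ultimately have "(\<lambda>n. B * (fps_nth H n * y ^ n)) sums jacobi_integral h 0 s" by simp
    then have "(\<lambda>n. B * (fps_nth H n * y ^ n) / B) sums (jacobi_integral h 0 s / B)" by (rule sums_divide)
    then show ?thesis using \<open>B \<noteq> 0\<close> by (simp add: F_def s_def)
  qed
  have F_fps: "F has_fps_expansion H"
  proof (rule has_fps_expansionI)
    have "eventually (\<lambda>y::complex. y \<in> ball 0 1) (nhds 0)"
      by (rule eventually_nhds_in_open) auto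
    then show "\<forall>\<^sub>F y in nhds 0. (\<lambda>n. fps_nth H n * y ^ n) sums F y"
      by eventually_elim (use sums in auto)
  qed
  \<comment> \<open>\<open>csqrt\<close> is not holomorphic on the nonpositive axis, so three open
    sets are used: \<open>U\<close>, where it is holomorphic; \<open>V\<close>, where
    \<open>\<i> * csqrt (- y)\<close> is a holomorphic root giving the same \<open>F\<close> by
    evenness; and the unit disc, which covers 0 and where \<open>F\<close> is a power
    series.\<close>
  define U where "U = hyp2F1_domain - \<real>\<^sub>\<le>\<^sub>0"
  define V where "V = hyp2F1_domain - \<real>\<^sub>\<ge>\<^sub>0"
  have open_UV: "open U" "open V"
    unfolding U_def V_def by (intro open_Diff open_hyp2F1_domain closed_nonpos_Reals_complex closed_nonneg_Reals_complex)+
  have root: "(\<lambda>y. jacobi_integral h 0 (s y) / B) holomorphic_on S"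
    if "open S" "s holomorphic_on S" "\<And>y. y \<in> S \<Longrightarrow> (s y)\<^sup>2 \<in> hyp2F1_domain" for s S
    using that h \<open>B \<noteq> 0\<close>
    by (intro holomorphic_on_divide jacobi_integral_holomorphic[where k = "\<lambda>_. 0"])
      (auto intro: slit_plane_if_square ball_subset_slit_plane)
  have U: "F holomorphic_on U"
    unfolding F_def by (rule root) (use open_UV in \<open>auto simp: U_def intro!: holomorphic_intros\<close>)
  have "(\<lambda>y. jacobi_integral h 0 (\<i> * csqrt (- y)) / B) holomorphic_on V"
    by (rule root) (use open_UV in \<open>auto simp: V_def power_mult_distrib intro!: holomorphic_intros\<close>)
  moreover have "jacobi_integral h 0 (\<i> * csqrt (- y)) = jacobi_integral h 0 (csqrt y)" for y
    by (rule jacobi_integral_zero_cong) (simp add: power_mult_distrib)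
  ultimately have V: "F holomorphic_on V" by (simp add: F_def)
  have W: "F holomorphic_on ball 0 1"
    by (rule power_series_holomorphic[where a = "fps_nth H"]) (use sums in auto)
  have "F holomorphic_on (U \<union> V) \<union> ball 0 1"
    using U V W open_UV by (intro holomorphic_on_Un) auto
  moreover have "hyp2F1_domain \<subseteq> (U \<union> V) \<union> ball 0 1"
  proof
    fix y assume "y \<in> hyp2F1_domain"
    moreover have "y = 0" if "y \<in> \<real>\<^sub>\<le>\<^sub>0" "y \<in> \<real>\<^sub>\<ge>\<^sub>0"
      using that by (auto simp: complex_nonpos_Reals_iff complex_nonneg_Reals_iff complex_eq_iff)
    ultimately show "y \<in> (U \<union> V) \<union> ball 0 1" by (auto simp: U_def V_def)
  qed
  ultimately have "F holomorphic_on hyp2F1_domain" by (rule holomorphic_on_subset)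
  from hyp2F1_eqI[OF this F_fps[unfolded H_def] z] have
    "hyp2F1 (of_real h / 2) (of_real h / 2 + 1 / 2) (of_real h + 1 / 2) (z\<^sup>2) = jacobi_integral h 0 (csqrt (z\<^sup>2)) / B"
    by (simp add: F_def)
  moreover have "jacobi_integral h 0 (csqrt (z\<^sup>2)) = jacobi_integral h 0 z" by (rule jacobi_integral_zero_cong) simp
  ultimately show ?thesis using \<open>B \<noteq> 0\<close> by (simp add: B_def)
qed

section \<open>Normalization and reduction of the contour integral\<close>

text \<open>Legendre's duplication formula, with Beta(1/2, h) = sqrt(pi) Gamma(h) / Gamma(h +
  1/2).\<close>

lemma propagator_normalization:
  assumes "h > 0"
  shows "2 / 4 powr of_real h * (Gamma (2 * of_real h) / (Gamma (of_real h) * Gamma (of_real h))) *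
    of_real (Beta (1 / 2) h) = (1 :: complex)"
proof -
  define g where "g = Gamma (complex_of_real h)"
  define g' where "g' = Gamma (complex_of_real h + 1 / 2)"
  have nonpos: "complex_of_real x \<notin> \<int>\<^sub>\<le>\<^sub>0" if "x > 0" for x
    using that by (auto elim!: nonpos_Ints_cases simp: complex_eq_iff)
  have h: "complex_of_real h \<notin> \<int>\<^sub>\<le>\<^sub>0" "complex_of_real h + 1 / 2 \<notin> \<int>\<^sub>\<le>\<^sub>0"
    using nonpos[of h] nonpos[of "h + 1 / 2"] assms by auto
  then have "g \<noteq> 0" "g' \<noteq> 0" by (simp_all add: g_def g'_def Gamma_eq_zero_iff)
  \<comment> \<open>The power 2^(1 - 2 h), in the exponential form in which the duplication formula
    has it.\<close>
  have "exp ((1 - 2 * complex_of_real h) * of_real (ln 2)) = 2 / 4 powr of_real h"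
  proof -
    have "ln (4 :: real) = 2 * ln 2" using ln_realpow[of 2 2] by simp
    then have "Ln 4 = 2 * of_real (ln 2)" using Ln_of_real[of 4] by simp
    moreover have "exp (of_real (ln 2)) = (2 :: complex)" by (subst exp_of_real) simp
    moreover from calculation(1) have "(1 - 2 * complex_of_real h) * of_real (ln 2) = of_real (ln 2) - of_real h * Ln 4"
      by (simp add: algebra_simps)
    ultimately show ?thesis by (simp only: exp_diff powr_def) simp
  qed
  then have dup: "g * g' = 2 / 4 powr of_real h * of_real (sqrt pi) * Gamma (2 * of_real h)"
    using Gamma_legendre_duplication[OF h] by (simp add: g_def g'_def)
  have "complex_of_real (Beta (1 / 2) h) = Beta (1 / 2) (of_real h)"
    using Beta_complex_of_real[of "1 / 2" h] by simp
  also have "\<dots> = of_real (sqrt pi) * g / g'"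
    by (simp add: Beta_def Gamma_one_half_complex g_def g'_def add.commute)
  finally have beta: "complex_of_real (Beta (1 / 2) h) = of_real (sqrt pi) * g / g'" .
  have "2 / 4 powr of_real h * (Gamma (2 * of_real h) / (g * g)) * of_real (Beta (1 / 2) h) =
      (2 / 4 powr of_real h * of_real (sqrt pi) * Gamma (2 * of_real h)) / (g * g')"
    unfolding beta using \<open>g \<noteq> 0\<close> \<open>g' \<noteq> 0\<close> by (simp add: field_simps)
  also have "\<dots> = 1" unfolding dup[symmetric] using \<open>g \<noteq> 0\<close> \<open>g' \<noteq> 0\<close> by simp
  finally show ?thesis by (simp add: g_def)
qed

lemma has_contour_integral_vertical:
  fixes f :: "complex \<Rightarrow> complex"
  assumes "((\<lambda>t. f (c + \<i> * of_real (r * t))) has_integral I) {-1..1}"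
  shows "(f has_contour_integral \<i> * of_real r * I) (linepath (c - \<i> * of_real r) (c + \<i> * of_real r))"
proof -
  define g where "g = (\<lambda>t. f (c + \<i> * of_real (r * t)))"
  have "(g has_integral I) (cbox (-1) 1)" using assms by (simp add: g_def)
  \<comment> \<open>The parameter of \<open>linepath\<close> runs over [0, 1], related to
    \<open>t\<close> by t = 2 x - 1.\<close>
  from has_integral_affinity'[OF this, of 2 "-1"]
  have "((\<lambda>x. g (2 * x + -1)) has_integral I / 2) {0..1}"
    by (simp add: scaleR_conv_of_real field_simps)
  from has_integral_mult_left[OF this, of "2 * \<i> * of_real r"]
  have "((\<lambda>x. g (2 * x + -1) * (2 * \<i> * of_real r)) has_integral \<i> * of_real r * I) {0..1}"
    by (simp add: mult_ac)
  moreover have "linepath (c - \<i> * of_real r) (c + \<i> * of_real r) x = c + \<i> * of_real (r * (2 * x + -1))" for x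
    by (simp add: linepath_def scaleR_conv_of_real algebra_simps)
  moreover have "c + \<i> * of_real r - (c - \<i> * of_real r) = 2 * \<i> * of_real r" by simp
  ultimately show ?thesis unfolding has_contour_integral_linepath g_def by (simp add: mult.assoc)
qed

text \<open>
  The factor \<open>e\<close> plays the role of \<open>(u / (u\<^sup>2 + \<zeta>\<^sup>2))\<^sup>h\<close>.  That the principal powers split compatibly in
  \<open>kernel\<close> and \<open>prefactor\<close> has different reasons for \<open>Re z = Re z'\<close> and \<open>Re z \<noteq> Re z'\<close>.
\<close>

lemma propagator_integral_core:
  fixes h u u' :: real and z z' :: complex
  defines "\<zeta> \<equiv> z - z'"
  defines "A \<equiv> of_real u + \<i> * \<zeta>" and "B \<equiv> of_real u - \<i> * \<zeta>"
  defines "k \<equiv> of_real u' / A" and "l \<equiv> of_real u' / B"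
  assumes pos: "h > 0" "u > 0" "u' > 0"
    and defd: "bulk_propagator_defined (u, z) (u', z')"
    and nz: "A \<noteq> 0" "B \<noteq> 0" and slit: "k \<in> slit_plane" "l \<in> slit_plane"
    and moebius: "jacobi_integral h k l = (1 + k * l) powr (- of_real h) * jacobi_integral h 0 ((k + l) / (1 + k * l))"
    and kernel: "\<And>t. t \<in> {-1<..<1} \<Longrightarrow>
      (of_real u / ((A + of_real (u' * t)) * (B - of_real (u' * t)))) powr of_real h =
        e * ((1 + k * of_real t) powr (- of_real h) * (1 - l * of_real t) powr (- of_real h))"
    and prefactor: "(of_real u * of_real u' / bulk_denom (u, z) (u', z')) powr of_real h =
      e * of_real (u' powr h) * (1 + k * l) powr (- of_real h)"
  shows "(propagator_kernel h (u, z) (u', z') has_contour_integral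
            bulk_propagator h (u, z) (u', z'))
          (linepath (z' - \<i> * of_real u') (z' + \<i> * of_real u'))"
proof -
  define G where "G = Gamma (2 * of_real h) / (Gamma (of_real h) * Gamma (complex_of_real h))"
  define N where "N = 2 / 4 powr of_real h * G"
  \<comment> \<open>All factors of the kernel that do not depend on \<open>t\<close>.\<close>
  define c where "c = - \<i> * (N * of_real (u' powr (h - 1)) * e)"
  define D where "D = bulk_denom (u, z) (u', z')"
  have "D \<noteq> 0" using defd by (simp add: bulk_propagator_defined_def D_def)
  \<comment> \<open>Here A B = u^2 + \<zeta>^2, so the denominator \<open>D\<close> of the
    propagator emerges from 1 + k l and then from \<eta>.\<close>
  have AB: "A * B + of_real u' ^ 2 = D"
    by (simp add: A_def B_def D_def \<zeta>_def algebra_simps power2_eq_square)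
  have kl: "1 + k * l = D / (A * B)"
    using nz by (simp add: k_def l_def field_simps power2_eq_square flip: AB)
  have "k + l = 2 * of_real u * of_real u' / (A * B)"
    using nz by (simp add: k_def l_def field_simps) (simp add: A_def B_def algebra_simps)
  then have \<eta>: "(k + l) / (1 + k * l) = 2 * of_real u * of_real u' / D"
    using nz \<open>D \<noteq> 0\<close> by (simp add: kl)
  have "((\<lambda>t. of_real (jacobi_weight h t) *
      ((1 + k * of_real t) powr (- of_real h) * (1 - l * of_real t) powr (- of_real h)))
        has_integral jacobi_integral h k l) {-1..1}"
    unfolding jacobi_integral_def
    by (intro integrable_integral set_lebesgue_integral_eq_integral(1)
        jacobi_integral_integrand_absolutely_integrable pos slit)
  then have "((\<lambda>t. c * (of_real (jacobi_weight h t) *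
      ((1 + k * of_real t) powr (- of_real h) * (1 - l * of_real t) powr (- of_real h))))
        has_integral c * jacobi_integral h k l) {-1..1}"
    by (rule has_integral_mult_right)
  then have "((\<lambda>t. propagator_kernel h (u, z) (u', z') (z' + \<i> * of_real (u' * t))) has_integral c * jacobi_integral h k l) {-1..1}"
  \<comment> \<open>The endpoints, where the first denominator vanishes, are discarded as a null
    set; \<open>kernel\<close> speaks of the open interval.\<close>
  proof (rule has_integral_spike_finite[of "{-1, 1}", rotated 2])
    fix t :: real assume "t \<in> {-1..1} - {-1, 1}"
    then have t: "t \<in> {-1<..<1}" by auto
    then have "1 - t\<^sup>2 > 0" by (simp add: abs_square_less_1 abs_less_iff)
    define w where "w = z' + \<i> * complex_of_real (u' * t)"
    \<comment> \<open>On the contour this denominator is a positive real, so the first principal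
      power is a real power.\<close>
    have "of_real u' ^ 2 + (z' - w) ^ 2 = of_real (u'\<^sup>2 * (1 - t\<^sup>2))"
      by (simp add: w_def power_mult_distrib algebra_simps)
    then have "of_real u' / (of_real u' ^ 2 + (z' - w) ^ 2) = complex_of_real (1 / (u' * (1 - t\<^sup>2)))"
      using pos by (simp add: power2_eq_square)
    moreover have "complex_of_real (1 / (u' * (1 - t\<^sup>2))) powr of_real (1 - h) =
        of_real ((1 / (u' * (1 - t\<^sup>2))) powr (1 - h))"
      using pos \<open>1 - t\<^sup>2 > 0\<close> by (intro powr_of_real) simp
    moreover have "(1 / (u' * (1 - t\<^sup>2))) powr (1 - h) = u' powr (h - 1) * jacobi_weight h t"
      using pos \<open>1 - t\<^sup>2 > 0\<close>
      by (simp add: jacobi_weight_def powr_def ln_div ln_mult flip: exp_add) (simp add: algebra_simps)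
    ultimately have 1: "(of_real u' / (of_real u' ^ 2 + (z' - w) ^ 2)) powr (1 - of_real h) =
        complex_of_real (u' powr (h - 1) * jacobi_weight h t)" by simp
    have "of_real u ^ 2 + (z - w) ^ 2 = (A + of_real (u' * t)) * (B - of_real (u' * t))"
      by (simp add: A_def B_def \<zeta>_def w_def algebra_simps power2_eq_square)
    with kernel[OF t] have 2: "(of_real u / (of_real u ^ 2 + (z - w) ^ 2)) powr of_real h =
        e * ((1 + k * of_real t) powr (- of_real h) * (1 - l * of_real t) powr (- of_real h))" by simp
    show "propagator_kernel h (u, z) (u', z') (z' + \<i> * of_real (u' * t)) = c * (of_real (jacobi_weight h t) *
      ((1 + k * of_real t) powr (- of_real h) * (1 - l * of_real t) powr (- of_real h)))"
      unfolding w_def[symmetric] propagator_kernel.simps 1 2 by (simp add: c_def N_def G_def mult_ac)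
  qed auto
  then have "(propagator_kernel h (u, z) (u', z') has_contour_integral \<i> * of_real u' * (c * jacobi_integral h k l))
      (linepath (z' - \<i> * of_real u') (z' + \<i> * of_real u'))"
    by (rule has_contour_integral_vertical)
  moreover have "\<i> * of_real u' * (c * jacobi_integral h k l) = bulk_propagator h (u, z) (u', z')"
  proof -
    have "u' * u' powr (h - 1) = u' powr h"
      using pos powr_add[of u' 1 "h - 1"] by simp
    then have u': "of_real u' * of_real (u' powr (h - 1)) = complex_of_real (u' powr h)"
      by (metis of_real_mult)
    have "\<i> * of_real u' * (c * jacobi_integral h k l) =
        N * (of_real u' * of_real (u' powr (h - 1))) * e * jacobi_integral h k l"
      unfolding c_def using i_squared by algebra
    also have "\<dots> = N * (e * of_real (u' powr h) * (1 + k * l) powr (- of_real h)) * jacobi_integral h 0 (2 * of_real u * of_real u' / D)"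
      unfolding u' moebius \<eta> by (simp add: mult_ac)
    also have "jacobi_integral h 0 (2 * of_real u * of_real u' / D) = of_real (Beta (1 / 2) h) *
        hyp2F1 (of_real h / 2) (of_real h / 2 + 1 / 2) (of_real h + 1 / 2) ((2 * of_real u * of_real u' / D)\<^sup>2)"
      using defd by (intro jacobi_integral_zero_hyp2F1 pos) (simp add: bulk_propagator_defined_def D_def)
    also have "N * (e * of_real (u' powr h) * (1 + k * l) powr (- of_real h)) * \<dots> =
        (N * of_real (Beta (1 / 2) h)) * bulk_propagator h (u, z) (u', z')"
      unfolding prefactor[symmetric] bulk_propagator.simps bulk_hyp_arg.simps D_def by (simp only: mult_ac)
    also have "N * of_real (Beta (1 / 2) h) = 1"
      unfolding N_def G_def using pos by (intro propagator_normalization)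
    finally show ?thesis by simp
  qed
  ultimately show ?thesis by simp
qed

section \<open>Splitting principal powers of products and quotients\<close>

lemma powr_of_real_divide:
  fixes x :: complex
  assumes "x \<notin> \<real>\<^sub>\<le>\<^sub>0" "c > 0"
  shows "(of_real c / x) powr s = of_real c powr s * x powr (- s)"
proof -
  have "x \<noteq> 0" using assms by auto
  have "(of_real c * inverse x) powr s = of_real c powr s * inverse x powr s"
    by (rule powr_times_real_left) (use assms in auto)
  moreover have "inverse x powr s = x powr (- s)"
    using \<open>x \<noteq> 0\<close> Ln_inverse[OF assms(1)] by (simp add: powr_def)
  ultimately show ?thesis by (simp add: divide_inverse)
qed

text \<open>The arguments have opposite signs, so their sum stays strictly between -pi and pi and
  the principal logarithms add.\<close>

lemma powr_mult_opposite_half_planes: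
  fixes x y :: complex
  assumes "Im x > 0 \<and> Im y < 0 \<or> Im x < 0 \<and> Im y > 0"
  shows "(x * y) powr s = x powr s * y powr s" "x * y \<notin> \<real>\<^sub>\<le>\<^sub>0"
proof -
  have nz: "x \<noteq> 0" "y \<noteq> 0" using assms by auto
  have range: "-pi < Im (Ln x) + Im (Ln y)" "Im (Ln x) + Im (Ln y) < pi"
    using assms Im_Ln_pos_lt_imp[of x] Im_Ln_pos_lt_imp[of y]
      Im_Ln_pos_le[OF nz(1)] Im_Ln_pos_le[OF nz(2)] mpi_less_Im_Ln[OF nz(1)] mpi_less_Im_Ln[OF nz(2)]
      Im_Ln_le_pi[OF nz(1)] Im_Ln_le_pi[OF nz(2)]
    by linarith+
  have Ln: "Ln (x * y) = Ln x + Ln y"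
    using nz range by (intro Ln_times_simple) auto
  then show "(x * y) powr s = x powr s * y powr s"
    using nz by (simp add: powr_def exp_add distrib_left)
  show "x * y \<notin> \<real>\<^sub>\<le>\<^sub>0"
  proof
    assume "x * y \<in> \<real>\<^sub>\<le>\<^sub>0"
    moreover have "Im (Ln w) = pi" if "w \<in> \<real>\<^sub>\<le>\<^sub>0" "w \<noteq> 0" for w
      using that by (subst Im_Ln_eq_pi) (auto simp: complex_nonpos_Reals_iff complex_eq_iff)
    ultimately have "Im (Ln (x * y)) = pi" using nz by simp
    then show False using range Ln by simp
  qed
qed

text \<open>Inversion moves \<open>y\<close> to the opposite half plane, which reduces the claim to
  a product; for real \<open>x\<close> a positive factor is pulled out instead.\<close>

lemma powr_divide_same_half_plane:
  fixes x y :: complex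
  assumes "Im x > 0 \<and> Im y > 0 \<or> Im x < 0 \<and> Im y < 0 \<or> Im x = 0 \<and> Im y = 0 \<and> Re x > 0 \<and> Re y > 0"
  shows "(x / y) powr s = x powr s * y powr (- s)"
proof -
  have nz: "x \<noteq> 0" "y \<noteq> 0" using assms by auto
  have y: "y \<notin> \<real>\<^sub>\<le>\<^sub>0" using assms by (auto simp: complex_nonpos_Reals_iff)
  show ?thesis
  proof (cases "Im x = 0")
    case True
    then have "x = of_real (Re x)" "Re x > 0" using assms by (auto simp: complex_eq_iff)
    then show ?thesis using powr_of_real_divide[OF y, of "Re x" s] by simp
  next
    case False
    have "(x * inverse y) powr s = x powr s * inverse y powr s"
    proof (rule powr_mult_opposite_half_planes)
      have "(Re y)\<^sup>2 + (Im y)\<^sup>2 > 0" using nz(2) by (simp add: sum_power2_gt_zero_iff complex_eq_iff)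
      then show "Im x > 0 \<and> Im (inverse y) < 0 \<or> Im x < 0 \<and> Im (inverse y) > 0"
        using assms False by (auto simp: divide_less_0_iff zero_less_divide_iff)
    qed
    moreover have "inverse y powr s = y powr (- s)"
      using powr_of_real_divide[OF y, of 1 s] by (simp add: divide_inverse)
    ultimately show ?thesis by (simp add: divide_inverse)
  qed
qed

text \<open>If 1 + c / x were some s \<le> 0, then x = c / (s - 1) would be real and
  nonpositive.\<close>

lemma one_plus_real_divide_notin_nonpos_Reals:
  fixes x :: complex
  assumes "x \<notin> \<real>\<^sub>\<le>\<^sub>0" "c \<ge> 0"
  shows "1 + of_real c / x \<notin> \<real>\<^sub>\<le>\<^sub>0"
proof
  assume "1 + of_real c / x \<in> \<real>\<^sub>\<le>\<^sub>0"
  then obtain s where s: "1 + of_real c / x = complex_of_real s" "s \<le> 0"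
    by (auto elim!: nonpos_Reals_cases)
  have "x \<noteq> 0" using assms by auto
  then have "of_real c = complex_of_real (s - 1) * x"
    using s(1) by (simp add: field_simps)
  then have "x = complex_of_real (c / (s - 1))" using s(2) by (simp add: field_simps complex_eq_iff)
  moreover have "c / (s - 1) \<le> 0" using s assms by (simp add: divide_nonneg_neg)
  ultimately show False using assms by (simp add: complex_nonpos_Reals_iff)
qed

section \<open>The two configurations of the boundary points\<close>

text \<open>\<open>A\<close> and \<open>B\<close> lie in opposite open half planes, with imaginary
  parts \<open>p\<close> and \<open>- p\<close>. This makes all principal powers split and keeps the
  ray of parameters inside the domain of the Moebius identity.\<close>

lemma propagator_integral_Re_neq:
  fixes h u u' :: real and z z' :: complex
  assumes pos: "h > 0" "u > 0" "u' > 0" and Re: "Re z \<noteq> Re z'"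
  shows "(propagator_kernel h (u, z) (u', z') has_contour_integral
            bulk_propagator h (u, z) (u', z'))
          (linepath (z' - \<i> * of_real u') (z' + \<i> * of_real u'))"
proof -
  define p q where "p = Re (z - z')" and "q = Im (z - z')"
  define A B where "A = of_real u + \<i> * (z - z')" and "B = of_real u - \<i> * (z - z')"
  define k l where "k = of_real u' / A" and "l = of_real u' / B"
  define E where "E = A * B"
  have "p \<noteq> 0" using Re by (simp add: p_def)
  have Im: "Im A = p" "Im B = - p" by (simp_all add: A_def B_def p_def)
  then have nz: "A \<noteq> 0" "B \<noteq> 0" using \<open>p \<noteq> 0\<close> by auto
  have opposite: "Im x > 0 \<and> Im y < 0 \<or> Im x < 0 \<and> Im y > 0" if "Im x = p" "Im y = - p" for x y
    using that \<open>p \<noteq> 0\<close> by auto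
  have "E \<noteq> 0" "E \<notin> \<real>\<^sub>\<le>\<^sub>0"
    using nz powr_mult_opposite_half_planes(2)[OF opposite[OF Im]] by (auto simp: E_def)
  \<comment> \<open>Stated for every radius, since the continuation runs through all
    \<open>r * u'\<close>.\<close>
  have denom: "bulk_denom (u, z) (r, z') = E + of_real r ^ 2" for r
    by (simp add: E_def A_def B_def algebra_simps power2_eq_square)
  have sum: "k + l = 2 * of_real u * of_real u' / E"
    using nz by (simp add: k_def l_def E_def field_simps) (simp add: A_def B_def algebra_simps)
  have prod: "k * l = of_real u' ^ 2 / E"
    by (simp add: k_def l_def E_def power2_eq_square)
  have Im_kl: "Im k \<noteq> 0" "Im l \<noteq> 0"
    using \<open>p \<noteq> 0\<close> pos nz Im by (auto simp: k_def l_def Im_divide complex_neq_0)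
  then have slit: "k \<in> slit_plane" "l \<in> slit_plane" by (auto simp: slit_plane_def)
  \<comment> \<open>Scaling \<open>k\<close> and \<open>l\<close> by \<open>r\<close> amounts to
    replacing \<open>u'\<close> by \<open>r * u'\<close>. For r > 0 the quotient is then off the
    cuts because the propagator is defined at the rescaled point.\<close>
  have "of_real r * k \<in> slit_plane \<and> of_real r * l \<in> slit_plane \<and>
      1 + (of_real r * k) * (of_real r * l) \<notin> \<real>\<^sub>\<le>\<^sub>0 \<and>
      (of_real r * k + of_real r * l) / (1 + (of_real r * k) * (of_real r * l)) \<in> slit_plane"
    if r: "r \<in> {0..1}" for r
  proof (cases "r = 0")
    case True
    then show ?thesis by (simp add: slit_plane_def)
  next
    case False
    have "(of_real r * k) * (of_real r * l) = of_real r ^ 2 * (k * l)"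
      by (simp add: power2_eq_square mult_ac)
    then have prod': "(of_real r * k) * (of_real r * l) = of_real ((r * u')\<^sup>2) / E"
      by (simp add: prod power_mult_distrib)
    moreover have "of_real r * k + of_real r * l = 2 * of_real u * of_real (r * u') / E"
      by (simp add: sum flip: distrib_left)
    moreover have "1 + of_real ((r * u')\<^sup>2) / E = bulk_denom (u, z) (r * u', z') / E"
      using \<open>E \<noteq> 0\<close> unfolding denom by (simp add: field_simps)
    ultimately have "(of_real r * k + of_real r * l) / (1 + (of_real r * k) * (of_real r * l)) =
        2 * of_real u * of_real (r * u') / bulk_denom (u, z) (r * u', z')"
      using \<open>E \<noteq> 0\<close> by (simp del: bulk_denom.simps)
    moreover have "bulk_propagator_defined (u, z) (r * u', z')"
      using bulk_propagator_defined_if_Re_neq[of u "r * u'" z z'] pos Re r False by simp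
    ultimately have "(of_real r * k + of_real r * l) / (1 + (of_real r * k) * (of_real r * l)) \<in> slit_plane"
      by (intro slit_plane_if_square) (simp add: bulk_propagator_defined_def del: bulk_denom.simps)
    moreover have "1 + (of_real r * k) * (of_real r * l) \<notin> \<real>\<^sub>\<le>\<^sub>0"
      using one_plus_real_divide_notin_nonpos_Reals[OF \<open>E \<notin> \<real>\<^sub>\<le>\<^sub>0\<close>, of "(r * u')\<^sup>2"] by (simp add: prod')
    ultimately show ?thesis using False Im_kl by (auto simp: slit_plane_def)
  qed
  then have moebius: "jacobi_integral h k l = (1 + k * l) powr (- of_real h) * jacobi_integral h 0 ((k + l) / (1 + k * l))"
    by (intro jacobi_integral_moebius pos) blast
  define e where "e = of_real u powr of_real h * (A powr (- of_real h) * B powr (- of_real h))"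
  show ?thesis
  proof (rule propagator_integral_core[OF pos, where z = z and z' = z' and e = e, folded A_def B_def, folded k_def l_def])
    show "bulk_propagator_defined (u, z) (u', z')"
      by (rule bulk_propagator_defined_if_Re_neq[OF pos(2,3) Re])
    fix t :: real assume t: "t \<in> {-1<..<1}"
    \<comment> \<open>Adding a real number leaves the imaginary parts unchanged:
      \<open>A' * B'\<close> is a product from opposite half planes, while \<open>A' / A\<close> and
      \<open>B' / B\<close> are quotients within one half plane.\<close>
    define A' B' where "A' = A + of_real (u' * t)" and "B' = B - of_real (u' * t)"
    have Im': "Im A' = p" "Im B' = - p" by (simp_all add: A'_def B'_def Im)
    note opp = opposite[OF Im']
    have quad: "(of_real u / (A' * B')) powr of_real h =
        of_real u powr of_real h * (A' powr (- of_real h) * B' powr (- of_real h))"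
      using powr_of_real_divide[OF powr_mult_opposite_half_planes(2)[OF opp]]
        powr_mult_opposite_half_planes(1)[OF opp] pos by simp
    have lin: "1 + k * of_real t = A' / A" "1 - l * of_real t = B' / B"
      using nz by (simp_all add: A'_def B'_def k_def l_def field_simps)
    have quot: "(A' / A) powr (- of_real h) = A' powr (- of_real h) * A powr (of_real h)"
      "(B' / B) powr (- of_real h) = B' powr (- of_real h) * B powr (of_real h)"
      by (subst powr_divide_same_half_plane; use \<open>p \<noteq> 0\<close> Im Im' in auto)+
    have "A powr (- of_real h) * A powr (of_real h) = 1" "B powr (- of_real h) * B powr (of_real h) = 1"
      using nz by (simp_all flip: powr_add)
    moreover have "e * ((A' / A) powr (- of_real h) * (B' / B) powr (- of_real h)) =
        of_real u powr of_real h * (A' powr (- of_real h) * B' powr (- of_real h)) *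
        (A powr (- of_real h) * A powr (of_real h)) * (B powr (- of_real h) * B powr (of_real h))"
      unfolding quot e_def by (simp only: mult_ac)
    ultimately show "(of_real u / ((A + of_real (u' * t)) * (B - of_real (u' * t)))) powr of_real h =
        e * ((1 + k * of_real t) powr (- of_real h) * (1 - l * of_real t) powr (- of_real h))"
      unfolding A'_def[symmetric] B'_def[symmetric] lin quad by simp
  next
    define D where "D = bulk_denom (u, z) (u', z')"
    have D: "D = E + of_real u' ^ 2" by (simp only: D_def denom)
    have Re_E: "Re E = u\<^sup>2 + p\<^sup>2 - q\<^sup>2" and Im_E: "Im E = 2 * p * q"
      by (simp_all add: E_def A_def B_def p_def q_def algebra_simps power2_eq_square)
    \<comment> \<open>\<open>D\<close> and \<open>E\<close> differ by a positive real, so their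
      imaginary parts agree. If these vanish, then q = 0 and both real parts are positive.\<close>
    have "(Re D > 0 \<and> Re E > 0) \<or> Im E \<noteq> 0"
      using \<open>p \<noteq> 0\<close> pos by (auto simp: D Re_E Im_E add_pos_nonneg)
    then have same: "Im D > 0 \<and> Im E > 0 \<or> Im D < 0 \<and> Im E < 0 \<or> Im D = 0 \<and> Im E = 0 \<and> Re D > 0 \<and> Re E > 0"
      by (auto simp: D)
    then have "D \<notin> \<real>\<^sub>\<le>\<^sub>0" by (auto simp: complex_nonpos_Reals_iff)
    then have quad: "(of_real (u * u') / D) powr of_real h = of_real (u * u') powr of_real h * D powr (- of_real h)"
      using pos by (intro powr_of_real_divide) auto
    have uu': "complex_of_real (u * u') powr of_real h = of_real u powr of_real h * of_real (u' powr h)"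
      using pos powr_times_real_left[of "of_real u" "of_real u'" "of_real h"] powr_of_real[of u' h] by simp
    have "1 + k * l = D / E" using \<open>E \<noteq> 0\<close> by (simp add: prod D field_simps)
    then have quot: "(1 + k * l) powr (- of_real h) = D powr (- of_real h) * E powr (of_real h)"
      using powr_divide_same_half_plane[OF same, of "- of_real h"] by simp
    have "E powr (- of_real h) * E powr (of_real h) = 1"
      using \<open>E \<noteq> 0\<close> by (simp flip: powr_add)
    moreover have "e = of_real u powr of_real h * E powr (- of_real h)"
      using powr_mult_opposite_half_planes(1)[OF opposite[OF Im]] by (simp add: E_def e_def)
    then have "e * of_real (u' powr h) * (1 + k * l) powr (- of_real h) =
        (of_real u powr of_real h * of_real (u' powr h)) * D powr (- of_real h) *
        (E powr (- of_real h) * E powr (of_real h))"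
      unfolding quot by (simp only: mult_ac)
    ultimately show "(of_real u * of_real u' / bulk_denom (u, z) (u', z')) powr of_real h =
        e * of_real (u' powr h) * (1 + k * l) powr (- of_real h)"
      using quad unfolding D_def[symmetric] uu' by auto
  qed (use nz slit moebius in auto)
qed

text \<open>Here \<open>A\<close>, \<open>B\<close>, \<open>k\<close> and \<open>l\<close> are real.
  The hypotheses force |k| < 1 and |l| < 1, so the real substitution applies directly.\<close>

lemma propagator_integral_Re_eq:
  fixes h u u' :: real and z z' :: complex
  assumes pos: "h > 0" "u > 0" "u' > 0" and Re: "Re z = Re z'"
    and Im: "u > u' - \<bar>Im (z - z')\<bar>"
    and defd: "bulk_propagator_defined (u, z) (u', z')"
  shows "(propagator_kernel h (u, z) (u', z') has_contour_integral
            bulk_propagator h (u, z) (u', z'))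
          (linepath (z' - \<i> * of_real u') (z' + \<i> * of_real u'))"
proof -
  define q where "q = Im (z - z')"
  have \<zeta>: "z - z' = \<i> * of_real q" using Re by (simp add: q_def complex_eq_iff)
  define d where "d = u\<^sup>2 + u'\<^sup>2 - q\<^sup>2"
  have denom: "bulk_denom (u, z) (u', z') = of_real d"
    by (simp add: d_def \<zeta> power_mult_distrib)
  have "d \<noteq> 0" using defd unfolding bulk_propagator_defined_def denom by simp
  have "bulk_hyp_arg (u, z) (u', z') = of_real ((2 * u * u' / d)\<^sup>2)"
    using denom by simp
  then have "(2 * u * u' / d)\<^sup>2 < 1"
    using defd unfolding bulk_propagator_defined_def hyp2F1_domain_def
    by (metis ComplI Compl_iff atLeast_iff image_eqI not_le)
  then have "\<bar>2 * u * u' / d\<bar> < 1" by (simp add: abs_square_less_1)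
  then have "2 * u * u' < \<bar>d\<bar>" using pos \<open>d \<noteq> 0\<close> by (simp add: abs_mult)
  \<comment> \<open>The sign of \<open>d\<close> decides: d > 2 u u' is the first alternative, d < -
    2 u u' the second.\<close>
  then have "q\<^sup>2 < (u - u')\<^sup>2 \<or> (u + u')\<^sup>2 < q\<^sup>2"
    by (auto simp: d_def abs_if power2_sum power2_diff split: if_splits)
  then have "\<bar>q\<bar> < \<bar>u - u'\<bar> \<or> \<bar>u + u'\<bar> < \<bar>q\<bar>"
    by (simp add: abs_le_square_iff flip: not_le)
  \<comment> \<open>The hypothesis \<open>Im\<close> rules out |q| < u' - u, the part of the first
    alternative with u < u'.\<close>
  then have cases: "\<bar>q\<bar> < u - u' \<or> u + u' < \<bar>q\<bar>"
    using Im pos unfolding q_def[symmetric] by arith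
  define \<kappa> where "\<kappa> = u' / (u - q)"
  define \<mu> where "\<mu> = u' / (u + q)"
  have "u' < \<bar>u - q\<bar>" "u' < \<bar>u + q\<bar>" using cases pos by auto
  then have bound: "\<bar>\<kappa>\<bar> < 1" "\<bar>\<mu>\<bar> < 1" and nz: "u - q \<noteq> 0" "u + q \<noteq> 0"
    using pos by (auto simp: \<kappa>_def \<mu>_def)
  define e where "e = u / ((u - q) * (u + q))"
  \<comment> \<open>\<open>e\<close> is negative when |q| > u + u', so its complex power is kept
    intact and only positive factors are pulled out.\<close>
  have scale: "(of_real (a * e)) powr of_real h = of_real e powr of_real h * complex_of_real (a powr h)"
    if "a > 0" for a
    using that powr_times_real_left[of "of_real a" "of_real e" "of_real h"] by (simp add: powr_of_real)
  have AB: "of_real u + \<i> * (z - z') = of_real (u - q)" "of_real u - \<i> * (z - z') = of_real (u + q)"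
    by (simp_all add: \<zeta>)
  show ?thesis
  proof (rule propagator_integral_core[OF pos defd, where e = "of_real e powr of_real h", unfolded AB])
    have kl: "of_real u' / complex_of_real (u - q) = of_real \<kappa>" "of_real u' / complex_of_real (u + q) = of_real \<mu>"
      by (simp_all add: \<kappa>_def \<mu>_def)
    show "of_real u' / complex_of_real (u - q) \<in> slit_plane" "of_real u' / complex_of_real (u + q) \<in> slit_plane"
      unfolding kl using bound by (auto simp: slit_plane_def)
    show "jacobi_integral h (of_real u' / of_real (u - q)) (of_real u' / of_real (u + q)) =
        (1 + of_real u' / of_real (u - q) * (of_real u' / of_real (u + q))) powr - of_real h *
        jacobi_integral h 0 ((of_real u' / of_real (u - q) + of_real u' / of_real (u + q)) /
          (1 + of_real u' / of_real (u - q) * (of_real u' / of_real (u + q))))"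
      unfolding kl by (rule jacobi_integral_moebius_real[OF pos(1) bound])
    have powr_real: "complex_of_real x powr (- of_real h) = of_real (x powr (- h))" if "x > 0" for x
      using powr_of_real[of x "- h"] that by simp
    fix t :: real assume t: "t \<in> {-1<..<1}"
    define P Q where "P = 1 + \<kappa> * t" and "Q = 1 - \<mu> * t"
    have "1 + \<kappa> * t > 0" "1 + (- \<mu>) * t > 0" by (rule one_plus_mult_pos; use t bound in auto)+
    then have PQ: "P > 0" "Q > 0" by (auto simp: P_def Q_def)
    have "u - q + u' * t = (u - q) * P" "u + q - u' * t = (u + q) * Q"
      using nz by (simp_all add: P_def Q_def \<kappa>_def \<mu>_def field_simps)
    then have "of_real u / ((of_real (u - q) + of_real (u' * t)) * (of_real (u + q) - of_real (u' * t))) =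
        complex_of_real (1 / (P * Q) * e)"
      by (simp add: e_def mult_ac flip: of_real_add of_real_diff of_real_mult of_real_divide)
    moreover have "(1 / (P * Q)) powr h = P powr (- h) * Q powr (- h)"
      using PQ by (simp add: powr_divide powr_mult powr_minus field_simps)
    ultimately show "(complex_of_real u / ((of_real (u - q) + of_real (u' * t)) * (of_real (u + q) - of_real (u' * t)))) powr of_real h =
        of_real e powr of_real h * ((1 + of_real u' / of_real (u - q) * of_real t) powr - of_real h *
          (1 - of_real u' / of_real (u + q) * of_real t) powr - of_real h)"
      unfolding kl using scale[of "1 / (P * Q)"] PQ powr_real[OF PQ(1)] powr_real[OF PQ(2)]
      by (simp add: P_def Q_def)
  next
    define R where "R = 1 + \<kappa> * \<mu>"
    have R: "R > 0" unfolding R_def by (rule one_plus_mult_pos) (use bound in auto)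
    have "d = (u - q) * (u + q) * R"
    proof -
      have root: "(u - q) * \<kappa> = u'" "(u + q) * \<mu> = u'" using nz by (simp_all add: \<kappa>_def \<mu>_def)
      have "(u - q) * (u + q) * (\<kappa> * \<mu>) = ((u - q) * \<kappa>) * ((u + q) * \<mu>)" by (simp only: mult_ac)
      then have "(u - q) * (u + q) * R = (u - q) * (u + q) + u' * u'"
        unfolding root R_def distrib_left by simp
      then show ?thesis by (simp add: d_def algebra_simps power2_eq_square)
    qed
    then have "of_real u * of_real u' / bulk_denom (u, z) (u', z') = complex_of_real (u' / R * e)"
      unfolding denom by (simp add: e_def mult_ac)
    moreover have "(u' / R) powr h = u' powr h * R powr (- h)"
      using pos R by (simp add: powr_divide powr_minus field_simps)
    moreover have "complex_of_real R powr (- of_real h) = of_real (R powr (- h))"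
      using powr_of_real[of R "- h"] R by simp
    moreover have "1 + of_real u' / of_real (u - q) * (of_real u' / of_real (u + q)) = complex_of_real R"
      by (simp add: R_def \<kappa>_def \<mu>_def)
    ultimately show "(of_real u * of_real u' / bulk_denom (u, z) (u', z')) powr of_real h =
        of_real e powr of_real h * of_real (u' powr h) *
        (1 + of_real u' / of_real (u - q) * (of_real u' / of_real (u + q))) powr - of_real h"
      using scale[of "u' / R"] pos R by (simp del: bulk_denom.simps add: mult_ac)
  qed (use nz in \<open>auto simp flip: of_real_diff of_real_add\<close>)
qed

theorem lemma1:
  fixes h u u' :: real and z z' :: complex
  assumes "h > 0" and "u > 0" and "u' > 0"
    and "Re z \<noteq> Re z' \<or> u > u' - \<bar>Im (z - z')\<bar>"
    and "bulk_propagator_defined (u, z) (u', z')"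
  shows "(propagator_kernel h (u, z) (u', z') has_contour_integral
            bulk_propagator h (u, z) (u', z'))
          (linepath (z' - \<i> * of_real u') (z' + \<i> * of_real u'))"
  using propagator_integral_Re_neq[OF assms(1-3)] propagator_integral_Re_eq[OF assms(1-3) _ _ assms(5)] assms(4)
  by blast

end
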